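(* Let $\mathcal{H}$ be a Hopf algebra with bijective antipode over a field $k$ of characteristic zero, let $A$ be a Yetter-Drinfeld $\mathcal{H}$-algebra, and let $V$ be a finite dimensional $\mathcal{H}$-module. For $n\ge0$ and $f\in C^n_{\mathcal{H}}(A)$ put $$\Psi^nf(a_0\otimes u_0,\dots,a_n\otimes u_n)(g)=f(a_{0<0>},a_{1<0>},\dots,a_{n<0>})(g^{(1)})\;\mathrm{tr}\bigl(S(a_{0<1>})u_0S(a_{1<1>})u_1\cdots S(a_{n<1>})u_n\,g^{(0)}\bigr)$$ for $a_i\in A$, $u_i\in\mathrm{End}(V)$, $g\in\mathcal{H}$. Then $\Psi^n$ maps equivariant cochains to equivariant cochains, i.e. $\Psi^n: C^n_{\mathcal{H}}(A)\to C^n_{\mathcal{H}}(A\otimes\mathrm{End}(V))$, and $\Psi=\{\Psi^n\}_{n\ge0}$ is a morphism of cocyclic modules (it commutes with all coface, codegeneracy and cyclic operators).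
   Context: Sweedler notation: $\Delta h=h^{(0)}\otimes h^{(1)}$, $\Delta^{(n)}h=h^{(0)}\otimes\cdots\otimes h^{(n)}$; $S,\epsilon$ are antipode and counit. Algebras are unital. A left $\mathcal{H}$-algebra is an algebra $A$ that is a left $\mathcal{H}$-module with $h\cdot(ab)=(h^{(0)}\cdot a)(h^{(1)}\cdot b)$, $h\cdot1=\epsilon(h)1$. A Yetter-Drinfeld $\mathcal{H}$-algebra is an algebra $A$ that is (1) a left $\mathcal{H}$-algebra; (2) a right $\mathcal{H}^{op}$-comodule algebra, i.e. there is a right coaction $\rho:A\to A\otimes\mathcal{H}$, $\rho(a)=a_{<0>}\otimes a_{<1>}$, with $\rho(ab)=a_{<0>}b_{<0>}\otimes b_{<1>}a_{<1>}$ and $\rho(1)=1\otimes1$; (3) satisfying $(h^{(1)}\cdot a)_{<0>}\otimes(h^{(1)}\cdot a)_{<1>}h^{(0)}=h^{(0)}\cdot a_{<0>}\otimes h^{(1)}a_{<1>}$. Elements of $\mathcal{H}$ also denote the operators by which they act on $V$. $\mathcal{H}$ acts on $\mathrm{End}(V)$ by $h\cdot u=h^{(0)}\circ u\circ S(h^{(1)})$, and $A\otimes\mathrm{End}(V)$ is the $\mathcal{H}$-algebra with $(a\otimes u)(c\otimes v)=ac_{<0>}\otimes(c_{<1>}\cdot u)v$ and $h\cdot(a\otimes u)=h^{(0)}\cdot a\otimes h^{(1)}\cdot u$. For any $\mathcal{H}$-algebra $A$, let $F(\mathcal{H})=\mathrm{Hom}_k(\mathcal{H},k)$; $C^n_{\mathcal{H}}(A)$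 is the space of $(n+1)$-linear maps $f:A^{\otimes(n+1)}\to F(\mathcal{H})$ that are equivariant: $f(h^{(0)}\cdot a_0,\dots,h^{(n)}\cdot a_n)(g)=f(a_0,\dots,a_n)(S(h^{(1)})gh^{(0)})$ for all $h,g\in\mathcal{H}$, $a_i\in A$. It is a cocyclic module with coface maps $\partial^i:C^{n-1}_{\mathcal{H}}(A)\to C^n_{\mathcal{H}}(A)$, $\partial^i f(a_0,\dots,a_n)(g)=f(a_0,\dots,a_ia_{i+1},\dots,a_n)(g)$ for $0\le i\le n-1$, $\partial^n f(a_0,\dots,a_n)(g)=f((S^{-1}(g^{(0)})\cdot a_n)a_0,a_1,\dots,a_{n-1})(g^{(1)})$, codegeneracies $\sigma^i:C^{n+1}_{\mathcal{H}}(A)\to C^n_{\mathcal{H}}(A)$, $\sigma^i f(a_0,\dots,a_n)(g)=f(a_0,\dots,a_i,1,a_{i+1},\dots,a_n)(g)$ for $0\le i\le n$, and cyclic operators $T_nf(a_0,\dots,a_n)(g)=f(S^{-1}(g^{(0)})\cdot a_n,a_0,\dots,a_{n-1})(g^{(1)})$. *)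

theory Defs
  imports Complex_Main "HOL-Library.Function_Algebras"
begin

section \<open>Tensor products of vector spaces\<close>

text \<open>
  A list over a set \<open>G\<close> of generators stands for the formal sum of its entries. \<open>formal_eq G R\<close>
  is the least congruence on the commutative monoid of formal sums that contains the relations \<open>R\<close>.
\<close>

inductive formal_eq :: "'g set \<Rightarrow> ('g list \<times> 'g list) set \<Rightarrow> 'g list \<Rightarrow> 'g list \<Rightarrow> bool"
  for G :: "'g set" and R :: "('g list \<times> 'g list) set" where
  rel: "(xs, ys) \<in> R \<Longrightarrow> formal_eq G R xs ys"
| refl: "xs \<in> lists G \<Longrightarrow> formal_eq G R xs xs"
| sym: "formal_eq G R xs ys \<Longrightarrow> formal_eq G R ys xs"
| trans: "formal_eq G R xs ys \<Longrightarrow> formal_eq G R ys zs \<Longrightarrow> formal_eq G R xs zs"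
| add: "formal_eq G R xs xs' \<Longrightarrow> formal_eq G R ys ys' \<Longrightarrow> formal_eq G R (xs @ ys) (xs' @ ys')"
| comm: "xs \<in> lists G \<Longrightarrow> ys \<in> lists G \<Longrightarrow> formal_eq G R (xs @ ys) (ys @ xs)"

text \<open>
  The tensor product of the spaces \<open>X\<close> (scalar multiplication \<open>s\<close>) and \<open>Y\<close> (scalar multiplication
  \<open>t\<close>): formal sums of pairs modulo the bilinearity relations. The list \<open>[(x, y)]\<close> represents
  the pure tensor of \<open>x\<close> and \<open>y\<close>.
\<close>

definition tensor_rels ::
    "'a::ab_group_add set \<Rightarrow> ('k \<Rightarrow> 'a \<Rightarrow> 'a) \<Rightarrow> 'b::ab_group_add set \<Rightarrow> ('k \<Rightarrow> 'b \<Rightarrow> 'b)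
      \<Rightarrow> (('a \<times> 'b) list \<times> ('a \<times> 'b) list) set" where
  "tensor_rels X s Y t =
     {([(x + x', y)], [(x, y), (x', y)]) | x x' y. x \<in> X \<and> x' \<in> X \<and> y \<in> Y}
   \<union> {([(x, y + y')], [(x, y), (x, y')]) | x y y'. x \<in> X \<and> y \<in> Y \<and> y' \<in> Y}
   \<union> {([(s c x, y)], [(x, t c y)]) | c x y. x \<in> X \<and> y \<in> Y}
   \<union> {([(0, y)], []) | y. y \<in> Y}"

definition tensor_class ::
    "'a::ab_group_add set \<Rightarrow> ('k \<Rightarrow> 'a \<Rightarrow> 'a) \<Rightarrow> 'b::ab_group_add set \<Rightarrow> ('k \<Rightarrow> 'b \<Rightarrow> 'b)
      \<Rightarrow> ('a \<times> 'b) list \<Rightarrow> ('a \<times> 'b) list set" where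
  "tensor_class X s Y t xs = {ys. formal_eq (X \<times> Y) (tensor_rels X s Y t) xs ys}"

definition tensor_space ::
    "'a::ab_group_add set \<Rightarrow> ('k \<Rightarrow> 'a \<Rightarrow> 'a) \<Rightarrow> 'b::ab_group_add set \<Rightarrow> ('k \<Rightarrow> 'b \<Rightarrow> 'b)
      \<Rightarrow> ('a \<times> 'b) list set set" where
  "tensor_space X s Y t = tensor_class X s Y t ` lists (X \<times> Y)"

text \<open>
  A chosen way to write a tensor as a finite sum of pure tensors. A Sweedler expression is a sum over
  \<open>sw (\<Delta> h)\<close> or \<open>sw (\<rho> a)\<close>; it does not depend on the choice when its terms are bilinear.
\<close>

definition sw :: "'g list set \<Rightarrow> 'g list" where
  "sw t = (SOME xs. xs \<in> t)"

definition tensor_add ::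
    "'a::ab_group_add set \<Rightarrow> ('k \<Rightarrow> 'a \<Rightarrow> 'a) \<Rightarrow> 'b::ab_group_add set \<Rightarrow> ('k \<Rightarrow> 'b \<Rightarrow> 'b)
      \<Rightarrow> ('a \<times> 'b) list set \<Rightarrow> ('a \<times> 'b) list set \<Rightarrow> ('a \<times> 'b) list set" where
  "tensor_add X s Y t p q = tensor_class X s Y t (sw p @ sw q)"

definition tensor_scale ::
    "'a::ab_group_add set \<Rightarrow> ('k \<Rightarrow> 'a \<Rightarrow> 'a) \<Rightarrow> 'b::ab_group_add set \<Rightarrow> ('k \<Rightarrow> 'b \<Rightarrow> 'b)
      \<Rightarrow> 'k \<Rightarrow> ('a \<times> 'b) list set \<Rightarrow> ('a \<times> 'b) list set" where
  "tensor_scale X s Y t c p = tensor_class X s Y t [(s c x, y). (x, y) \<leftarrow> sw p]"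

definition linear_into_tensor ::
    "('k \<Rightarrow> 'c::ab_group_add \<Rightarrow> 'c) \<Rightarrow> ('k \<Rightarrow> 'a::ab_group_add \<Rightarrow> 'a) \<Rightarrow> ('k \<Rightarrow> 'b::ab_group_add \<Rightarrow> 'b)
      \<Rightarrow> ('c \<Rightarrow> ('a \<times> 'b) list set) \<Rightarrow> bool" where
  "linear_into_tensor r s t F \<longleftrightarrow>
     (\<forall>x. F x \<in> tensor_space UNIV s UNIV t) \<and>
     (\<forall>x y. F (x + y) = tensor_add UNIV s UNIV t (F x) (F y)) \<and>
     (\<forall>c x. F (r c x) = tensor_scale UNIV s UNIV t c (F x))"

text \<open>Equality in a threefold tensor product.\<close>

definition tensor3_rels ::
    "('k \<Rightarrow> 'a::ab_group_add \<Rightarrow> 'a) \<Rightarrow> ('k \<Rightarrow> 'b::ab_group_add \<Rightarrow> 'b) \<Rightarrow> ('k \<Rightarrow> 'c::ab_group_add \<Rightarrow> 'c)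
      \<Rightarrow> (('a \<times> 'b \<times> 'c) list \<times> ('a \<times> 'b \<times> 'c) list) set" where
  "tensor3_rels r s t =
     {([(x + x', y, z)], [(x, y, z), (x', y, z)]) | x x' y z. True}
   \<union> {([(x, y + y', z)], [(x, y, z), (x, y', z)]) | x y y' z. True}
   \<union> {([(x, y, z + z')], [(x, y, z), (x, y, z')]) | x y z z'. True}
   \<union> {([(r c x, y, z)], [(x, s c y, z)]) | c x y z. True}
   \<union> {([(x, s c y, z)], [(x, y, t c z)]) | c x y z. True}
   \<union> {([(0, y, z)], []) | y z. True}"

definition tensor3_eq ::
    "('k \<Rightarrow> 'a::ab_group_add \<Rightarrow> 'a) \<Rightarrow> ('k \<Rightarrow> 'b::ab_group_add \<Rightarrow> 'b) \<Rightarrow> ('k \<Rightarrow> 'c::ab_group_add \<Rightarrow> 'c)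
      \<Rightarrow> ('a \<times> 'b \<times> 'c) list \<Rightarrow> ('a \<times> 'b \<times> 'c) list \<Rightarrow> bool" where
  "tensor3_eq r s t = formal_eq UNIV (tensor3_rels r s t)"


section \<open>Hopf algebras, modules and Yetter-Drinfeld algebras\<close>

text \<open>The sort \<open>{ring, monoid_mult}\<close> is \<open>ring_1\<close> without \<open>0 \<noteq> 1\<close>, so the zero algebra is allowed.\<close>

locale unital_algebra = vector_space scale
  for scale :: "'k::field \<Rightarrow> 'a::{ring, monoid_mult} \<Rightarrow> 'a" +
  assumes scale_mult_left: "scale c x * y = scale c (x * y)"
    and scale_mult_right: "x * scale c y = scale c (x * y)"

record ('k, 'h) hopf_data =
  hscale :: "'k \<Rightarrow> 'h \<Rightarrow> 'h"
  comult :: "'h \<Rightarrow> ('h \<times> 'h) list set"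
  counit :: "'h \<Rightarrow> 'k"
  antipode :: "'h \<Rightarrow> 'h"

abbreviation sweedler :: "('k, 'h) hopf_data \<Rightarrow> 'h \<Rightarrow> ('h \<times> 'h) list" where
  "sweedler H h \<equiv> sw (comult H h)"

locale hopf_algebra =
  fixes H :: "('k::field, 'h::{ring, monoid_mult}) hopf_data"
  assumes algebra: "unital_algebra (hscale H)"
    and comult_linear: "linear_into_tensor (hscale H) (hscale H) (hscale H) (comult H)"
    and comult_mult: "comult H (g * h) =
          tensor_class UNIV (hscale H) UNIV (hscale H)
            [(g0 * h0, g1 * h1). (g0, g1) \<leftarrow> sweedler H g, (h0, h1) \<leftarrow> sweedler H h]"
    and comult_one: "comult H 1 = tensor_class UNIV (hscale H) UNIV (hscale H) [(1, 1)]"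
    and coassoc: "tensor3_eq (hscale H) (hscale H) (hscale H)
          [(x, y, h1). (h0, h1) \<leftarrow> sweedler H h, (x, y) \<leftarrow> sweedler H h0]
          [(h0, x, y). (h0, h1) \<leftarrow> sweedler H h, (x, y) \<leftarrow> sweedler H h1]"
    and counit_linear: "Vector_Spaces.linear (hscale H) (*) (counit H)"
    and counit_mult: "counit H (g * h) = counit H g * counit H h"
    and counit_one: "counit H 1 = 1"
    and counit_left: "(\<Sum>(h0, h1)\<leftarrow>sweedler H h. hscale H (counit H h0) h1) = h"
    and counit_right: "(\<Sum>(h0, h1)\<leftarrow>sweedler H h. hscale H (counit H h1) h0) = h"
    and antipode_linear: "Vector_Spaces.linear (hscale H) (hscale H) (antipode H)"
    and antipode_left: "(\<Sum>(h0, h1)\<leftarrow>sweedler H h. antipode H h0 * h1) = hscale H (counit H h) 1"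
    and antipode_right: "(\<Sum>(h0, h1)\<leftarrow>sweedler H h. h0 * antipode H h1) = hscale H (counit H h) 1"

locale hopf_module =
  fixes H :: "('k::field, 'h::{ring, monoid_mult}) hopf_data"
    and scale :: "'k \<Rightarrow> 'v::ab_group_add \<Rightarrow> 'v"
    and act :: "'h \<Rightarrow> 'v \<Rightarrow> 'v"
  assumes vector_space: "vector_space scale"
    and act_linear: "Vector_Spaces.linear scale scale (act h)"
    and act_add: "act (g + h) v = act g v + act h v"
    and act_scale: "act (hscale H c h) v = scale c (act h v)"
    and act_mult: "act (g * h) v = act g (act h v)"
    and act_one: "act 1 v = v"

locale hopf_module_algebra =
  hopf_module H scale act + unital_algebra scale
  for H :: "('k::field, 'h::{ring, monoid_mult}) hopf_data"
    and scale :: "'k \<Rightarrow> 'a::{ring, monoid_mult} \<Rightarrow> 'a"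
    and act :: "'h \<Rightarrow> 'a \<Rightarrow> 'a" +
  assumes act_prod: "act h (a * b) = (\<Sum>(h0, h1)\<leftarrow>sweedler H h. act h0 a * act h1 b)"
    and act_unit: "act h 1 = scale (counit H h) 1"

locale yetter_drinfeld_algebra =
  hopf_module_algebra H scale act
  for H :: "('k::field, 'h::{ring, monoid_mult}) hopf_data"
    and scale :: "'k \<Rightarrow> 'a::{ring, monoid_mult} \<Rightarrow> 'a"
    and act :: "'h \<Rightarrow> 'a \<Rightarrow> 'a" +
  fixes coact :: "'a \<Rightarrow> ('a \<times> 'h) list set"
  assumes coact_linear: "linear_into_tensor scale scale (hscale H) coact"
    and coact_coassoc: "tensor3_eq scale (hscale H) (hscale H)
          [(x, y, a1). (a0, a1) \<leftarrow> sw (coact a), (x, y) \<leftarrow> sw (coact a0)]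
          [(a0, x, y). (a0, a1) \<leftarrow> sw (coact a), (x, y) \<leftarrow> sweedler H a1]"
    and coact_counit: "(\<Sum>(a0, a1)\<leftarrow>sw (coact a). scale (counit H a1) a0) = a"
    and coact_mult: "coact (a * b) =
          tensor_class UNIV scale UNIV (hscale H)
            [(a0 * b0, b1 * a1). (a0, a1) \<leftarrow> sw (coact a), (b0, b1) \<leftarrow> sw (coact b)]"
    and coact_one: "coact 1 = tensor_class UNIV scale UNIV (hscale H) [(1, 1)]"
    and yetter_drinfeld:
      "tensor_class UNIV scale UNIV (hscale H)
         [(x0, x1 * h0). (h0, h1) \<leftarrow> sweedler H h, (x0, x1) \<leftarrow> sw (coact (act h1 a))] =
       tensor_class UNIV scale UNIV (hscale H)
         [(act h0 a0, h1 * a1). (h0, h1) \<leftarrow> sweedler H h, (a0, a1) \<leftarrow> sw (coact a)]"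


section \<open>Equivariant cochains\<close>

text \<open>
  Algebras with an action, given by a carrier and explicit operations. The carrier is needed since
  \<open>A \<otimes> End(V)\<close> is a set of equivalence classes which depends on the scalar multiplications.
\<close>

record ('k, 'h, 'x) act_alg =
  car :: "'x set"
  add :: "'x \<Rightarrow> 'x \<Rightarrow> 'x"
  smul :: "'k \<Rightarrow> 'x \<Rightarrow> 'x"
  mul :: "'x \<Rightarrow> 'x \<Rightarrow> 'x"
  unt :: "'x"
  act :: "'h \<Rightarrow> 'x \<Rightarrow> 'x"

definition type_alg ::
    "('k \<Rightarrow> 'a::{ring, monoid_mult} \<Rightarrow> 'a) \<Rightarrow> ('h \<Rightarrow> 'a \<Rightarrow> 'a) \<Rightarrow> ('k, 'h, 'a) act_alg" where
  "type_alg scale ac =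
     \<lparr>car = UNIV, add = (+), smul = scale, mul = (*), unt = 1, act = ac\<rparr>"

definition tuples :: "('k, 'h, 'x) act_alg \<Rightarrow> nat \<Rightarrow> 'x list set" where
  "tuples M n = {xs. length xs = n \<and> set xs \<subseteq> car M}"

text \<open>\<open>\<Delta>\<^sup>(\<^sup>n\<^sup>) h\<close> as a formal sum of words of length \<open>n + 1\<close>.\<close>

primrec iter_sweedler :: "('k, 'h) hopf_data \<Rightarrow> nat \<Rightarrow> 'h \<Rightarrow> 'h list list" where
  "iter_sweedler H 0 h = [[h]]"
| "iter_sweedler H (Suc n) h = [h0 # w. (h0, h1) \<leftarrow> sweedler H h, w \<leftarrow> iter_sweedler H n h1]"

text \<open>
  An \<open>n\<close>-cochain is a function on lists; it is normalised to be zero off the tuples of \<open>n + 1\<close>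
  elements of the carrier, so that equality of cochains is equality of functions.
\<close>

definition multilinear_cochain ::
    "('k::field, 'h::{ring, monoid_mult}) hopf_data \<Rightarrow> ('k, 'h, 'x) act_alg \<Rightarrow> nat
      \<Rightarrow> ('x list \<Rightarrow> 'h \<Rightarrow> 'k) \<Rightarrow> bool" where
  "multilinear_cochain H M n f \<longleftrightarrow>
     (\<forall>as. as \<notin> tuples M (n + 1) \<longrightarrow> f as = (\<lambda>g. 0)) \<and>
     (\<forall>as\<in>tuples M (n + 1). Vector_Spaces.linear (hscale H) (*) (f as)) \<and>
     (\<forall>as\<in>tuples M (n + 1). \<forall>i\<le>n. \<forall>x\<in>car M. \<forall>y\<in>car M. \<forall>g.
        f (as[i := add M x y]) g = f (as[i := x]) g + f (as[i := y]) g) \<and>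
     (\<forall>as\<in>tuples M (n + 1). \<forall>i\<le>n. \<forall>c. \<forall>x\<in>car M. \<forall>g.
        f (as[i := smul M c x]) g = c * f (as[i := x]) g)"

definition cochains ::
    "('k::field, 'h::{ring, monoid_mult}) hopf_data \<Rightarrow> ('k, 'h, 'x) act_alg \<Rightarrow> nat
      \<Rightarrow> ('x list \<Rightarrow> 'h \<Rightarrow> 'k) set" where
  "cochains H M n = {f. multilinear_cochain H M n f \<and>
     (\<forall>as\<in>tuples M (n + 1). \<forall>h g.
        (\<Sum>hs\<leftarrow>iter_sweedler H n h. f (map2 (act M) hs as) g) =
        (\<Sum>(h0, h1)\<leftarrow>sweedler H h. f as (antipode H h1 * g * h0)))}"

text \<open>\<open>\<partial>\<^sup>i\<close> from \<open>(n - 1)\<close>-cochains to \<open>n\<close>-cochains, for \<open>n \<ge> 1\<close> and \<open>i \<le> n\<close>.\<close>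

definition coface ::
    "('k::field, 'h::{ring, monoid_mult}) hopf_data \<Rightarrow> ('k, 'h, 'x) act_alg \<Rightarrow> nat \<Rightarrow> nat
      \<Rightarrow> ('x list \<Rightarrow> 'h \<Rightarrow> 'k) \<Rightarrow> 'x list \<Rightarrow> 'h \<Rightarrow> 'k" where
  "coface H M n i f as g =
     (if as \<notin> tuples M (n + 1) then 0
      else if i < n then f (take i as @ mul M (as ! i) (as ! (i + 1)) # drop (i + 2) as) g
      else (\<Sum>(g0, g1)\<leftarrow>sweedler H g.
              f (mul M (act M (inv (antipode H) g0) (as ! n)) (as ! 0) # drop 1 (take n as)) g1))"

text \<open>\<open>\<sigma>\<^sup>i\<close> from \<open>(n + 1)\<close>-cochains to \<open>n\<close>-cochains, for \<open>i \<le> n\<close>.\<close>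

definition codegeneracy ::
    "('k::field, 'h, 'x) act_alg \<Rightarrow> nat \<Rightarrow> nat
      \<Rightarrow> ('x list \<Rightarrow> 'h \<Rightarrow> 'k) \<Rightarrow> 'x list \<Rightarrow> 'h \<Rightarrow> 'k" where
  "codegeneracy M n i f as g =
     (if as \<notin> tuples M (n + 1) then 0
      else f (take (i + 1) as @ unt M # drop (i + 1) as) g)"

definition cyclic_op ::
    "('k::field, 'h::{ring, monoid_mult}) hopf_data \<Rightarrow> ('k, 'h, 'x) act_alg \<Rightarrow> nat
      \<Rightarrow> ('x list \<Rightarrow> 'h \<Rightarrow> 'k) \<Rightarrow> 'x list \<Rightarrow> 'h \<Rightarrow> 'k" where
  "cyclic_op H M n f as g =
     (if as \<notin> tuples M (n + 1) then 0
      else (\<Sum>(g0, g1)\<leftarrow>sweedler H g.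
              f (act M (inv (antipode H) g0) (as ! n) # take n as) g1))"


section \<open>The algebra \<open>A \<otimes> End(V)\<close> and the map \<open>\<Psi>\<close>\<close>

definition finite_dim :: "('k::field \<Rightarrow> 'v::ab_group_add \<Rightarrow> 'v) \<Rightarrow> bool" where
  "finite_dim scale \<longleftrightarrow> (\<exists>B. finite B \<and> module.span scale B = UNIV)"

definition trace :: "('k::field \<Rightarrow> 'v::ab_group_add \<Rightarrow> 'v) \<Rightarrow> ('v \<Rightarrow> 'v) \<Rightarrow> 'k" where
  "trace scale u =
     (let B = (SOME B. \<not> module.dependent scale B \<and> module.span scale B = UNIV)
      in \<Sum>b\<in>B. module.representation scale B (u b) b)"

definition endos :: "('k::field \<Rightarrow> 'v::ab_group_add \<Rightarrow> 'v) \<Rightarrow> ('v \<Rightarrow> 'v) set" where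
  "endos scale = {u. Vector_Spaces.linear scale scale u}"

definition end_scale :: "('k \<Rightarrow> 'v \<Rightarrow> 'v) \<Rightarrow> 'k \<Rightarrow> ('v \<Rightarrow> 'v) \<Rightarrow> 'v \<Rightarrow> 'v" where
  "end_scale scale c u = (\<lambda>v. scale c (u v))"

definition end_act ::
    "('k, 'h) hopf_data \<Rightarrow> ('h \<Rightarrow> 'v::ab_group_add \<Rightarrow> 'v) \<Rightarrow> 'h \<Rightarrow> ('v \<Rightarrow> 'v) \<Rightarrow> 'v \<Rightarrow> 'v" where
  "end_act H actV h u = (\<Sum>(h0, h1)\<leftarrow>sweedler H h. actV h0 \<circ> u \<circ> actV (antipode H h1))"

definition end_class ::
    "('k::field \<Rightarrow> 'a::ab_group_add \<Rightarrow> 'a) \<Rightarrow> ('k \<Rightarrow> 'v::ab_group_add \<Rightarrow> 'v)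
      \<Rightarrow> ('a \<times> ('v \<Rightarrow> 'v)) list \<Rightarrow> ('a \<times> ('v \<Rightarrow> 'v)) list set" where
  "end_class scaleA scaleV = tensor_class UNIV scaleA (endos scaleV) (end_scale scaleV)"

definition end_alg ::
    "('k::field, 'h::{ring, monoid_mult}) hopf_data
      \<Rightarrow> ('k \<Rightarrow> 'a::{ring, monoid_mult} \<Rightarrow> 'a) \<Rightarrow> ('h \<Rightarrow> 'a \<Rightarrow> 'a) \<Rightarrow> ('a \<Rightarrow> ('a \<times> 'h) list set)
      \<Rightarrow> ('k \<Rightarrow> 'v::ab_group_add \<Rightarrow> 'v) \<Rightarrow> ('h \<Rightarrow> 'v \<Rightarrow> 'v)
      \<Rightarrow> ('k, 'h, ('a \<times> ('v \<Rightarrow> 'v)) list set) act_alg" where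
  "end_alg H scaleA actA coact scaleV actV =
     \<lparr>car = tensor_space UNIV scaleA (endos scaleV) (end_scale scaleV),
      add = tensor_add UNIV scaleA (endos scaleV) (end_scale scaleV),
      smul = tensor_scale UNIV scaleA (endos scaleV) (end_scale scaleV),
      mul = (\<lambda>p q. end_class scaleA scaleV
               [(a * c0, end_act H actV c1 u \<circ> v).
                  (a, u) \<leftarrow> sw p, (c, v) \<leftarrow> sw q, (c0, c1) \<leftarrow> sw (coact c)]),
      unt = end_class scaleA scaleV [(1, id)],
      act = (\<lambda>h p. end_class scaleA scaleV
               [(actA h0 a, end_act H actV h1 u). (a, u) \<leftarrow> sw p, (h0, h1) \<leftarrow> sweedler H h])\<rparr>"

text \<open>
  The defining formula of \<open>\<Psi>\<^sup>n f\<close> on pure tensors: \<open>aus\<close> is the list of the pairs \<open>(a\<^sub>i, u\<^sub>i)\<close>, and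
  \<open>xs\<close> runs through the choices of one term of each \<open>\<rho>(a\<^sub>i)\<close>.
\<close>

definition Psi_pure ::
    "('k::field, 'h::{ring, monoid_mult}) hopf_data \<Rightarrow> ('a \<Rightarrow> ('a \<times> 'h) list set)
      \<Rightarrow> ('k \<Rightarrow> 'v::ab_group_add \<Rightarrow> 'v) \<Rightarrow> ('h \<Rightarrow> 'v \<Rightarrow> 'v)
      \<Rightarrow> ('a list \<Rightarrow> 'h \<Rightarrow> 'k) \<Rightarrow> ('a \<times> ('v \<Rightarrow> 'v)) list \<Rightarrow> 'h \<Rightarrow> 'k" where
  "Psi_pure H coact scaleV actV f aus g =
     (\<Sum>(g0, g1)\<leftarrow>sweedler H g.
        \<Sum>xs\<leftarrow>product_lists (map (\<lambda>(a, u). sw (coact a)) aus).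
          f (map fst xs) g1 *
          trace scaleV
            (foldr (\<circ>) (map2 (\<lambda>(a0, a1) (a, u). actV (antipode H a1) \<circ> u) xs aus) (actV g0)))"

text \<open>Multilinear extension of \<open>Psi_pure\<close> to all of \<open>A \<otimes> End(V)\<close>.\<close>

definition Psi ::
    "('k::field, 'h::{ring, monoid_mult}) hopf_data
      \<Rightarrow> ('k \<Rightarrow> 'a::{ring, monoid_mult} \<Rightarrow> 'a) \<Rightarrow> ('h \<Rightarrow> 'a \<Rightarrow> 'a) \<Rightarrow> ('a \<Rightarrow> ('a \<times> 'h) list set)
      \<Rightarrow> ('k \<Rightarrow> 'v::ab_group_add \<Rightarrow> 'v) \<Rightarrow> ('h \<Rightarrow> 'v \<Rightarrow> 'v) \<Rightarrow> nat
      \<Rightarrow> ('a list \<Rightarrow> 'h \<Rightarrow> 'k) \<Rightarrow> ('a \<times> ('v \<Rightarrow> 'v)) list set list \<Rightarrow> 'h \<Rightarrow> 'k" where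
  "Psi H scaleA actA coact scaleV actV n f bs g =
     (if bs \<notin> tuples (end_alg H scaleA actA coact scaleV actV) (n + 1) then 0
      else \<Sum>aus\<leftarrow>product_lists (map sw bs). Psi_pure H coact scaleV actV f aus g)"

text \<open>Morphisms between the cocyclic modules of two algebras.\<close>

definition cocyclic_morphism ::
    "('k::field, 'h::{ring, monoid_mult}) hopf_data
      \<Rightarrow> ('k, 'h, 'x) act_alg \<Rightarrow> ('k, 'h, 'y) act_alg
      \<Rightarrow> (nat \<Rightarrow> ('x list \<Rightarrow> 'h \<Rightarrow> 'k) \<Rightarrow> ('y list \<Rightarrow> 'h \<Rightarrow> 'k)) \<Rightarrow> bool" where
  "cocyclic_morphism H M N \<Phi> \<longleftrightarrow>
     (\<forall>n. \<forall>f\<in>cochains H M n. \<Phi> n f \<in> cochains H N n) \<and>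
     (\<forall>n. \<forall>f\<in>cochains H M n. \<forall>f'\<in>cochains H M n. \<forall>bs g.
        \<Phi> n (\<lambda>as g. f as g + f' as g) bs g = \<Phi> n f bs g + \<Phi> n f' bs g) \<and>
     (\<forall>n c. \<forall>f\<in>cochains H M n. \<forall>bs g. \<Phi> n (\<lambda>as g. c * f as g) bs g = c * \<Phi> n f bs g) \<and>
     (\<forall>n\<ge>1. \<forall>i\<le>n. \<forall>f\<in>cochains H M (n - 1).
        \<Phi> n (coface H M n i f) = coface H N n i (\<Phi> (n - 1) f)) \<and>
     (\<forall>n. \<forall>i\<le>n. \<forall>f\<in>cochains H M (n + 1).
        \<Phi> n (codegeneracy M n i f) = codegeneracy N n i (\<Phi> (n + 1) f)) \<and>
     (\<forall>n. \<forall>f\<in>cochains H M n. \<Phi> n (cyclic_op H M n f) = cyclic_op H N n (\<Phi> n f))"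

end

theory Submission
  imports Defs
begin

text \<open>
  The twist \<open>\<theta>(a \<otimes> u) = a\<^sub>0 \<otimes> S(a\<^sub>1)u\<close> carries the twisted product of \<open>A \<otimes> End(V)\<close> to the ordinary
  one, \<open>(a \<otimes> w)(a' \<otimes> w') = aa' \<otimes> ww'\<close>, and the action of \<open>h\<close> to
  \<open>a \<otimes> w \<mapsto> h\<^sub>1 \<cdot> a \<otimes> h\<^sub>0 w S(h\<^sub>2)\<close>; the latter is the Yetter-Drinfeld condition in the form
  \<open>\<rho>(h \<cdot> a) = h\<^sub>1 \<cdot> a\<^sub>0 \<otimes> h\<^sub>2 a\<^sub>1 S\<^sup>-\<^sup>1(h\<^sub>0)\<close>. After \<open>\<theta>\<close>, the map \<open>\<Psi>\<close> is just
  \<open>f(a\<^sub>0, \<dots>, a\<^sub>n)(g\<^sub>1) tr(w\<^sub>0 \<cdots> w\<^sub>n g\<^sub>0)\<close>. In an iterated action the inner factors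
  \<open>S(h\<^sub>i) h\<^bsub>i+1\<^esub>\<close> cancel, so equivariance and the compatibility with the cyclic operator reduce to
  the cyclicity of the trace. The last coface is \<open>T\<^sub>n \<partial>\<^sup>0\<close>.
\<close>

section \<open>Sums over formal tensors\<close>

lemma sum_list_swap:
  "(\<Sum>x\<leftarrow>xs. \<Sum>y\<leftarrow>ys. F x y) = (\<Sum>y\<leftarrow>ys. \<Sum>x\<leftarrow>xs. F x y :: 'z::comm_monoid_add)"
  by (induction xs) (simp_all add: sum_list_addf)

lemma sum_list_cong:
  "(\<And>x. x \<in> set xs \<Longrightarrow> F x = G x) \<Longrightarrow> (\<Sum>x\<leftarrow>xs. F x) = (\<Sum>x\<leftarrow>xs. G x)"
  by (metis map_cong)

lemma sum_list_pair_cong: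
  "(\<And>x y. (x, y) \<in> set xs \<Longrightarrow> F x y = G x y) \<Longrightarrow> (\<Sum>(x, y)\<leftarrow>xs. F x y) = (\<Sum>(x, y)\<leftarrow>xs. G x y)"
  by (rule sum_list_cong) auto

lemma sum_list_pair_swap:
  "(\<Sum>(x, y)\<leftarrow>xs. \<Sum>(u, v)\<leftarrow>ys. F x y u v) =
   (\<Sum>(u, v)\<leftarrow>ys. \<Sum>(x, y)\<leftarrow>xs. F x y u v :: 'z::comm_monoid_add)"
  unfolding case_prod_unfold by (rule sum_list_swap)

lemma sum_list_pair_swap_nested:
  "(\<Sum>(x, y)\<leftarrow>xs. \<Sum>(u, v)\<leftarrow>us x y. \<Sum>(a, b)\<leftarrow>zs. F x y u v a b) =
   (\<Sum>(a, b)\<leftarrow>zs. \<Sum>(x, y)\<leftarrow>xs. \<Sum>(u, v)\<leftarrow>us x y. F x y u v a b :: 'z::comm_monoid_add)"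
proof -
  have "(\<Sum>(x, y)\<leftarrow>xs. \<Sum>(u, v)\<leftarrow>us x y. \<Sum>(a, b)\<leftarrow>zs. F x y u v a b) =
      (\<Sum>(x, y)\<leftarrow>xs. \<Sum>(a, b)\<leftarrow>zs. \<Sum>(u, v)\<leftarrow>us x y. F x y u v a b)"
    by (intro sum_list_pair_cong sum_list_pair_swap)
  also have "\<dots> = (\<Sum>(a, b)\<leftarrow>zs. \<Sum>(x, y)\<leftarrow>xs. \<Sum>(u, v)\<leftarrow>us x y. F x y u v a b)"
    by (rule sum_list_pair_swap)
  finally show ?thesis .
qed

lemma sum_list_pair_swap_list:
  "(\<Sum>(x, y)\<leftarrow>xs. \<Sum>z\<leftarrow>zs. F x y z) = (\<Sum>z\<leftarrow>zs. \<Sum>(x, y)\<leftarrow>xs. F x y z :: 'z::comm_monoid_add)"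
  unfolding case_prod_unfold by (rule sum_list_swap)

lemma sum_list_pair_mult_const:
  "(\<Sum>(x, y)\<leftarrow>xs. F x y * c) = (\<Sum>(x, y)\<leftarrow>xs. F x y) * (c :: 'z::semiring_0)"
  by (simp add: case_prod_unfold sum_list_mult_const)

lemma sum_list_pair_const_mult:
  "(\<Sum>(x, y)\<leftarrow>xs. c * F x y) = (c :: 'z::semiring_0) * (\<Sum>(x, y)\<leftarrow>xs. F x y)"
  by (simp add: case_prod_unfold sum_list_const_mult)

lemma sum_list_concat_map:
  "(\<Sum>z\<leftarrow>concat (map g xs). F z) = (\<Sum>x\<leftarrow>xs. \<Sum>z\<leftarrow>g x. F z :: 'z::monoid_add)"
  by (induction xs) auto

section \<open>Linear, bilinear and trilinear maps\<close>

abbreviation linear_map ::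
    "('k::field \<Rightarrow> 'x::ab_group_add \<Rightarrow> 'x) \<Rightarrow> ('k \<Rightarrow> 'z::ab_group_add \<Rightarrow> 'z) \<Rightarrow> ('x \<Rightarrow> 'z) \<Rightarrow> bool" where
  "linear_map \<equiv> Vector_Spaces.linear"

named_theorems linear_intros

lemma linear_map_add: "linear_map s t F \<Longrightarrow> F (x + y) = F x + F y"
  and linear_map_scale: "linear_map s t F \<Longrightarrow> F (s c x) = t c (F x)"
  by (simp_all add: Vector_Spaces.linear_iff)

lemma linear_map_zero: "linear_map s t F \<Longrightarrow> F 0 = 0"
  using linear_map_add[of s t F 0 0] by simp

lemma linear_map_sum_list_pair:
  "linear_map s t F \<Longrightarrow> F (\<Sum>(x, y)\<leftarrow>xs. G x y) = (\<Sum>(x, y)\<leftarrow>xs. F (G x y))"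
  by (induction xs) (auto simp: linear_map_zero linear_map_add)

lemma linear_map_comp: "linear_map s t G \<Longrightarrow> linear_map r s T \<Longrightarrow> linear_map r t (\<lambda>x. G (T x))"
  by (simp add: Vector_Spaces.linear_iff)

lemma linear_map_sum_list:
  assumes "vector_space s" and "vector_space t" and "\<And>u. u \<in> set us \<Longrightarrow> linear_map s t (\<lambda>x. F x u)"
  shows "linear_map s t (\<lambda>x. \<Sum>u\<leftarrow>us. F x u)"
proof -
  interpret vector_space_pair s t
    using assms by (simp add: vector_space_pair_def)
  show ?thesis
    using assms(3) by (induction us) (auto intro: linear_zero linear_compose_add)
qed

lemma linear_map_sum_list_case_prod [linear_intros]:
  assumes "vector_space s" and "vector_space t"
    and "\<And>u v. (u, v) \<in> set us \<Longrightarrow> linear_map s t (\<lambda>x. F x u v)"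
  shows "linear_map s t (\<lambda>x. \<Sum>(u, v)\<leftarrow>us. F x u v)"
  using assms by (auto simp: case_prod_unfold intro!: linear_map_sum_list)

lemma linear_map_mult_left:
  "unital_algebra t \<Longrightarrow> linear_map s t T \<Longrightarrow> linear_map s t (\<lambda>x. T x * y)"
  and linear_map_mult_right:
  "unital_algebra t \<Longrightarrow> linear_map s t T \<Longrightarrow> linear_map s t (\<lambda>x. y * T x)"
  by (auto simp: Vector_Spaces.linear_iff unital_algebra.scale_mult_left
      unital_algebra.scale_mult_right distrib_left distrib_right)

lemma unital_algebra_field: "unital_algebra ((*) :: 'k::field \<Rightarrow> 'k \<Rightarrow> 'k)"
  by unfold_locales (auto simp: algebra_simps)

lemmas [linear_intros] =
  linear_map_mult_left[OF unital_algebra_field] linear_map_mult_right[OF unital_algebra_field]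
  unital_algebra.axioms(1)[OF unital_algebra_field]

definition bilinear ::
    "('k::field \<Rightarrow> 'x::ab_group_add \<Rightarrow> 'x) \<Rightarrow> ('k \<Rightarrow> 'y::ab_group_add \<Rightarrow> 'y) \<Rightarrow>
     ('k \<Rightarrow> 'z::ab_group_add \<Rightarrow> 'z) \<Rightarrow> ('x \<Rightarrow> 'y \<Rightarrow> 'z) \<Rightarrow> bool" where
  "bilinear r s t F \<longleftrightarrow> (\<forall>y. linear_map r t (\<lambda>x. F x y)) \<and> (\<forall>x. linear_map s t (F x))"

lemma bilinearI [linear_intros]:
  "(\<And>y. linear_map r t (\<lambda>x. F x y)) \<Longrightarrow> (\<And>x. linear_map s t (\<lambda>y. F x y)) \<Longrightarrow> bilinear r s t F"
  by (simp add: bilinear_def)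

lemma bilinear_left: "bilinear r s t F \<Longrightarrow> linear_map q r T \<Longrightarrow> linear_map q t (\<lambda>x. F (T x) y)"
  by (auto simp: bilinear_def intro: linear_map_comp)

lemma bilinear_right: "bilinear r s t F \<Longrightarrow> linear_map q s T \<Longrightarrow> linear_map q t (\<lambda>y. F x (T y))"
  by (auto simp: bilinear_def intro: linear_map_comp)

lemma bilinear_vector_space: "bilinear r s t F \<Longrightarrow> vector_space t"
  by (auto simp: bilinear_def Vector_Spaces.linear_iff)

definition trilinear ::
    "('k::field \<Rightarrow> 'x::ab_group_add \<Rightarrow> 'x) \<Rightarrow> ('k \<Rightarrow> 'y::ab_group_add \<Rightarrow> 'y) \<Rightarrow>
     ('k \<Rightarrow> 'w::ab_group_add \<Rightarrow> 'w) \<Rightarrow> ('k \<Rightarrow> 'z::ab_group_add \<Rightarrow> 'z) \<Rightarrow> ('x \<Rightarrow> 'y \<Rightarrow> 'w \<Rightarrow> 'z) \<Rightarrow> bool" where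
  "trilinear q r s t F \<longleftrightarrow>
     (\<forall>y z. linear_map q t (\<lambda>x. F x y z)) \<and> (\<forall>x z. linear_map r t (\<lambda>y. F x y z)) \<and>
     (\<forall>x y. linear_map s t (F x y))"

lemma trilinearI [linear_intros]:
  "(\<And>y z. linear_map q t (\<lambda>x. F x y z)) \<Longrightarrow> (\<And>x z. linear_map r t (\<lambda>y. F x y z)) \<Longrightarrow>
   (\<And>x y. linear_map s t (\<lambda>z. F x y z)) \<Longrightarrow> trilinear q r s t F"
  by (simp add: trilinear_def)

definition multilinear ::
    "('k::field \<Rightarrow> 'x::ab_group_add \<Rightarrow> 'x) \<Rightarrow> ('k \<Rightarrow> 'z::ab_group_add \<Rightarrow> 'z) \<Rightarrow> nat \<Rightarrow>
     ('x list \<Rightarrow> 'z) \<Rightarrow> bool" where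
  "multilinear s t n F \<longleftrightarrow>
     (\<forall>xs ys. length xs + length ys + 1 = n \<longrightarrow> linear_map s t (\<lambda>x. F (xs @ x # ys)))"

lemma multilinear_slot:
  "multilinear s t n F \<Longrightarrow> length xs + length ys + 1 = n \<Longrightarrow> linear_map r s T \<Longrightarrow>
   linear_map r t (\<lambda>x. F (xs @ T x # ys))"
  by (rule linear_map_comp[where T = T]) (simp_all add: multilinear_def)

lemma multilinear_head:
  "multilinear s t (Suc n) F \<Longrightarrow> length ys = n \<Longrightarrow> linear_map r s T \<Longrightarrow> linear_map r t (\<lambda>x. F (T x # ys))"
  using multilinear_slot[of s t "Suc n" F "[]" ys r T] by simp

lemma multilinear_Cons:
  assumes "multilinear s t (Suc n) F"
  shows "multilinear s t n (\<lambda>xs. F (x # xs))"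
  unfolding multilinear_def
proof (intro allI impI)
  fix xs ys :: "'b list"
  assume "length xs + length ys + 1 = n"
  then show "linear_map s t (\<lambda>y. F (x # xs @ y # ys))"
    using assms[unfolded multilinear_def, rule_format, of "x # xs" ys] by simp
qed

section \<open>Well-definedness of Sweedler sums\<close>

lemma formal_eq_imp_sum_list_eq:
  assumes "formal_eq G R xs ys"
    and "\<And>xs ys. (xs, ys) \<in> R \<Longrightarrow> (\<Sum>x\<leftarrow>xs. F x) = (\<Sum>y\<leftarrow>ys. F y)"
  shows "(\<Sum>x\<leftarrow>xs. F x) = (\<Sum>y\<leftarrow>ys. F y :: 'z::ab_group_add)"
  using assms by (induction rule: formal_eq.induct) (auto simp: add.commute)

lemma formal_eq_imp_lists:
  assumes "formal_eq G R xs ys" and "R \<subseteq> lists G \<times> lists G"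
  shows "xs \<in> lists G" and "ys \<in> lists G"
  using assms by (induction rule: formal_eq.induct) auto

lemma tensor_eq_imp_sum_eq:
  assumes "formal_eq (X \<times> Y) (tensor_rels X s Y t) xs ys" and F: "bilinear s t q F"
  shows "(\<Sum>(x, y)\<leftarrow>xs. F x y) = (\<Sum>(x, y)\<leftarrow>ys. F x y)"
proof (rule formal_eq_imp_sum_list_eq[OF assms(1)])
  have left: "linear_map s q (\<lambda>x. F x y)" and right: "linear_map t q (F x)" for x y
    using F by (simp_all add: bilinear_def)
  fix xs ys assume "(xs, ys) \<in> tensor_rels X s Y t"
  then show "(\<Sum>(x, y)\<leftarrow>xs. F x y) = (\<Sum>(x, y)\<leftarrow>ys. F x y)"
    unfolding tensor_rels_def
    by (auto simp: linear_map_add[OF left] linear_map_add[OF right] linear_map_zero[OF left]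
        linear_map_scale[OF left] linear_map_scale[OF right])
qed

lemma tensor3_eq_imp_sum_eq:
  assumes "tensor3_eq r s t xs ys" and F: "trilinear r s t q F"
  shows "(\<Sum>(x, y, z)\<leftarrow>xs. F x y z) = (\<Sum>(x, y, z)\<leftarrow>ys. F x y z)"
proof (rule formal_eq_imp_sum_list_eq[OF assms(1)[unfolded tensor3_eq_def]])
  have lin: "linear_map r q (\<lambda>x. F x y z)" "linear_map s q (\<lambda>y. F x y z)"
    "linear_map t q (F x y)" for x y z
    using F by (simp_all add: trilinear_def)
  fix xs ys assume "(xs, ys) \<in> tensor3_rels r s t"
  then show "(\<Sum>(x, y, z)\<leftarrow>xs. F x y z) = (\<Sum>(x, y, z)\<leftarrow>ys. F x y z)"
    unfolding tensor3_rels_def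
    by (auto simp: linear_map_add[OF lin(1)] linear_map_add[OF lin(2)] linear_map_add[OF lin(3)]
        linear_map_scale[OF lin(1)] linear_map_scale[OF lin(2)] linear_map_scale[OF lin(3)]
        linear_map_zero[OF lin(1)])
qed

lemma formal_eq_sw_tensor_class:
  "xs \<in> lists (X \<times> Y) \<Longrightarrow>
    formal_eq (X \<times> Y) (tensor_rels X s Y t) xs (sw (tensor_class X s Y t xs))"
  unfolding sw_def tensor_class_def by (rule someI2[of _ xs]) (auto intro: formal_eq.refl)

lemma sum_sw_tensor_class:
  assumes "bilinear s t q F" and "xs \<in> lists (X \<times> Y)"
  shows "(\<Sum>(x, y)\<leftarrow>sw (tensor_class X s Y t xs). F x y) = (\<Sum>(x, y)\<leftarrow>xs. F x y)"
  using tensor_eq_imp_sum_eq[OF formal_eq_sw_tensor_class[OF assms(2)] assms(1)] by simp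

lemma linear_map_sum_sw:
  assumes D: "linear_into_tensor r s t D" and F: "bilinear s t q F" and "vector_space r"
  shows "linear_map r q (\<lambda>x. \<Sum>(y, z)\<leftarrow>sw (D x). F y z)"
proof -
  have q: "vector_space q" and left: "linear_map s q (\<lambda>x. F x y)" for y
    using F by (auto simp: bilinear_def Vector_Spaces.linear_iff)
  have add: "(\<Sum>(u, v)\<leftarrow>sw (D (x + y)). F u v) =
      (\<Sum>(u, v)\<leftarrow>sw (D x). F u v) + (\<Sum>(u, v)\<leftarrow>sw (D y). F u v)" for x y
    using D sum_sw_tensor_class[OF F] by (simp add: linear_into_tensor_def tensor_add_def)
  have "(\<Sum>(u, v)\<leftarrow>sw (D (r c x)). F u v) = (\<Sum>(u, v)\<leftarrow>sw (D x). F (s c u) v)" for c x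
    using D sum_sw_tensor_class[OF F]
    by (simp add: linear_into_tensor_def tensor_scale_def comp_def case_prod_unfold)
  also have "(\<Sum>(u, v)\<leftarrow>sw (D x). F (s c u) v) = q c (\<Sum>(u, v)\<leftarrow>sw (D x). F u v)" for c x
    by (simp add: linear_map_scale[OF left]
        linear_map_sum_list_pair[OF vector_space.linear_scale_self[OF q]])
  finally show ?thesis
    using add q \<open>vector_space r\<close> by (simp add: Vector_Spaces.linear_iff)
qed

section \<open>Hopf algebras\<close>

context hopf_algebra
begin

abbreviation "\<Delta> \<equiv> sweedler H"
abbreviation "\<epsilon> \<equiv> counit H"
abbreviation "S \<equiv> antipode H"

sublocale hopf: unital_algebra "hscale H"
  by (rule algebra)

lemma linear_map_sweedler [linear_intros]:
  assumes "linear_map s (hscale H) T"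
    and "\<And>z. linear_map (hscale H) t (\<lambda>y. F y z)" and "\<And>y. linear_map (hscale H) t (F y)"
  shows "linear_map s t (\<lambda>x. \<Sum>(y, z)\<leftarrow>\<Delta> (T x). F y z)"
  by (rule linear_map_comp[OF
        linear_map_sum_sw[OF comult_linear bilinearI hopf.vector_space_axioms]])
    (use assms in auto)

lemmas [linear_intros] =
  hopf.linear_ident hopf.vector_space_axioms
  linear_map_mult_left[OF hopf.unital_algebra_axioms]
  linear_map_mult_right[OF hopf.unital_algebra_axioms]
  linear_map_comp[OF antipode_linear]

lemma coassoc_sum:
  assumes "trilinear (hscale H) (hscale H) (hscale H) t F"
  shows "(\<Sum>(h0, h1)\<leftarrow>\<Delta> h. \<Sum>(x, y)\<leftarrow>\<Delta> h0. F x y h1) = (\<Sum>(h0, h1)\<leftarrow>\<Delta> h. \<Sum>(x, y)\<leftarrow>\<Delta> h1. F h0 x y)"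
  using tensor3_eq_imp_sum_eq[OF coassoc[of h] assms]
  by (simp add: sum_list_concat_map comp_def case_prod_unfold)

lemma comult_mult_sum:
  assumes "bilinear (hscale H) (hscale H) t F"
  shows "(\<Sum>(x, y)\<leftarrow>\<Delta> (g * h). F x y) = (\<Sum>(g0, g1)\<leftarrow>\<Delta> g. \<Sum>(h0, h1)\<leftarrow>\<Delta> h. F (g0 * h0) (g1 * h1))"
  unfolding comult_mult
  by (subst sum_sw_tensor_class[OF assms])
    (simp_all add: sum_list_concat_map comp_def case_prod_unfold)

lemma comult_one_sum:
  assumes "bilinear (hscale H) (hscale H) t F"
  shows "(\<Sum>(x, y)\<leftarrow>\<Delta> 1. F x y) = F 1 1"
  unfolding comult_one by (subst sum_sw_tensor_class[OF assms]) simp_all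

lemma counit_left_sum:
  assumes "linear_map (hscale H) t F"
  shows "(\<Sum>(x, y)\<leftarrow>\<Delta> h. F (hscale H (\<epsilon> x) y)) = F h"
  unfolding linear_map_sum_list_pair[OF assms, symmetric] counit_left ..

lemma counit_right_sum:
  assumes "linear_map (hscale H) t F"
  shows "(\<Sum>(x, y)\<leftarrow>\<Delta> h. F (hscale H (\<epsilon> y) x)) = F h"
  unfolding linear_map_sum_list_pair[OF assms, symmetric] counit_right ..

definition cancelling :: "('h \<Rightarrow> 'h \<Rightarrow> 'h) \<Rightarrow> bool" where
  "cancelling m \<longleftrightarrow> bilinear (hscale H) (hscale H) (hscale H) m \<and>
     (\<forall>h. (\<Sum>(x, y)\<leftarrow>\<Delta> h. m x y) = hscale H (\<epsilon> h) 1)"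

lemma cancelling_antipode_left: "cancelling (\<lambda>x y. S x * y)"
  and cancelling_antipode_right: "cancelling (\<lambda>x y. x * S y)"
  by (auto simp: cancelling_def antipode_left antipode_right intro!: linear_intros)

lemma sum_cancelling:
  assumes "cancelling m" and "linear_map (hscale H) t F"
  shows "(\<Sum>(x, y)\<leftarrow>\<Delta> h. F (m x y)) = t (\<epsilon> h) (F 1)"
  using assms(1) unfolding linear_map_sum_list_pair[OF assms(2), symmetric]
  by (simp add: cancelling_def linear_map_scale[OF assms(2)])

lemma cancel_left:
  assumes m: "cancelling m" and F: "bilinear (hscale H) (hscale H) t F"
  shows "(\<Sum>(x, k)\<leftarrow>\<Delta> h. \<Sum>(y, z)\<leftarrow>\<Delta> k. F (m x y) z) = F 1 h"
proof -
  have lin: "bilinear (hscale H) (hscale H) (hscale H) m" "linear_map (hscale H) t (\<lambda>x. F x z)"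
    "linear_map (hscale H) t (F x)" for x z
    using m F by (simp_all add: cancelling_def bilinear_def)
  have "(\<Sum>(x, k)\<leftarrow>\<Delta> h. \<Sum>(y, z)\<leftarrow>\<Delta> k. F (m x y) z) = (\<Sum>(k, z)\<leftarrow>\<Delta> h. \<Sum>(x, y)\<leftarrow>\<Delta> k. F (m x y) z)"
    by (rule coassoc_sum[where t = t, symmetric])
      (intro linear_intros bilinear_left[OF F] bilinear_right[OF F] bilinear_left[OF lin(1)]
        bilinear_right[OF lin(1)])
  also have "\<dots> = (\<Sum>(k, z)\<leftarrow>\<Delta> h. F 1 (hscale H (\<epsilon> k) z))"
    by (simp add: sum_cancelling[OF m lin(2)] linear_map_scale[OF lin(3)])
  also have "\<dots> = F 1 h"
    by (rule counit_left_sum[OF lin(3)])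
  finally show ?thesis .
qed

lemma cancel_right:
  assumes m: "cancelling m" and F: "bilinear (hscale H) (hscale H) t F"
  shows "(\<Sum>(x, k)\<leftarrow>\<Delta> h. \<Sum>(y, z)\<leftarrow>\<Delta> k. F x (m y z)) = F h 1"
proof -
  have lin: "linear_map (hscale H) t (\<lambda>x. F x z)" "linear_map (hscale H) t (F x)" for x z
    using F by (simp_all add: bilinear_def)
  have "(\<Sum>(x, k)\<leftarrow>\<Delta> h. \<Sum>(y, z)\<leftarrow>\<Delta> k. F x (m y z)) = (\<Sum>(x, k)\<leftarrow>\<Delta> h. F (hscale H (\<epsilon> k) x) 1)"
    by (simp add: sum_cancelling[OF m lin(2)] linear_map_scale[OF lin(1)])
  also have "\<dots> = F h 1"
    by (rule counit_right_sum[OF lin(1)])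
  finally show ?thesis .
qed

lemma cancel_inner:
  assumes m: "cancelling m" and outer: "\<And>y z. bilinear (hscale H) (hscale H) t (\<lambda>p q. F p q y z)"
    and inner: "\<And>p q. bilinear (hscale H) (hscale H) t (F p q)"
  shows "(\<Sum>(h0, h1)\<leftarrow>\<Delta> h. \<Sum>(p, k)\<leftarrow>\<Delta> h0. \<Sum>(q, x)\<leftarrow>\<Delta> k. \<Sum>(y, z)\<leftarrow>\<Delta> h1. F p q (m x y) z) =
    (\<Sum>(p, k)\<leftarrow>\<Delta> h. \<Sum>(q, z)\<leftarrow>\<Delta> k. F p q 1 z)"
proof -
  have "bilinear (hscale H) (hscale H) (hscale H) m"
    using m by (simp add: cancelling_def)
  note lin = linear_intros bilinear_left[OF outer] bilinear_right[OF outer] bilinear_left[OF inner]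
    bilinear_right[OF inner] bilinear_left[OF this] bilinear_right[OF this]
    bilinear_vector_space[OF inner]
  have "(\<Sum>(h0, h1)\<leftarrow>\<Delta> h. \<Sum>(p, k)\<leftarrow>\<Delta> h0. \<Sum>(q, x)\<leftarrow>\<Delta> k. \<Sum>(y, z)\<leftarrow>\<Delta> h1. F p q (m x y) z) =
      (\<Sum>(p, l)\<leftarrow>\<Delta> h. \<Sum>(k, h1)\<leftarrow>\<Delta> l. \<Sum>(q, x)\<leftarrow>\<Delta> k. \<Sum>(y, z)\<leftarrow>\<Delta> h1. F p q (m x y) z)"
    by (rule coassoc_sum[where t = t]) (intro lin)
  also have "\<dots> = (\<Sum>(p, l)\<leftarrow>\<Delta> h. \<Sum>(q, k)\<leftarrow>\<Delta> l. \<Sum>(x, h1)\<leftarrow>\<Delta> k. \<Sum>(y, z)\<leftarrow>\<Delta> h1. F p q (m x y) z)"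
    by (rule sum_list_pair_cong, rule coassoc_sum[where t = t]) (intro lin)
  also have "\<dots> = (\<Sum>(p, l)\<leftarrow>\<Delta> h. \<Sum>(q, z)\<leftarrow>\<Delta> l. F p q 1 z)"
    by (intro sum_list_pair_cong cancel_left[where t = t] m inner)
  finally show ?thesis .
qed

lemma antipode_one: "S 1 = 1"
proof -
  have "S 1 * 1 = (\<Sum>(x, y)\<leftarrow>\<Delta> 1. S x * y)"
    by (rule comult_one_sum[where t = "hscale H", symmetric]) (intro linear_intros)
  then show ?thesis by (simp add: antipode_left counit_one)
qed

lemma antipode_mult_cancel: "(\<Sum>(g0, g1)\<leftarrow>\<Delta> g. S (g0 * h) * g1) = hscale H (\<epsilon> g) (S h)"
proof -
  have "(\<Sum>(g0, g1)\<leftarrow>\<Delta> g. S (g0 * h) * g1) =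
      (\<Sum>(g0, g1)\<leftarrow>\<Delta> g. \<Sum>(h0, k)\<leftarrow>\<Delta> h. \<Sum>(h1, h2)\<leftarrow>\<Delta> k. S (g0 * h0) * g1 * (h1 * S h2))"
    by (subst cancel_right[where t = "hscale H", OF cancelling_antipode_right])
      (simp | intro linear_intros)+
  also have "\<dots> = (\<Sum>(g0, g1)\<leftarrow>\<Delta> g. \<Sum>(k, h2)\<leftarrow>\<Delta> h. \<Sum>(h0, h1)\<leftarrow>\<Delta> k. S (g0 * h0) * g1 * (h1 * S h2))"
    by (rule sum_list_pair_cong, rule coassoc_sum[where t = "hscale H", symmetric])
      (intro linear_intros)
  also have "\<dots> = (\<Sum>(k, h2)\<leftarrow>\<Delta> h. \<Sum>(g0, g1)\<leftarrow>\<Delta> g. \<Sum>(h0, h1)\<leftarrow>\<Delta> k. S (g0 * h0) * (g1 * h1) * S h2)"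
    by (subst sum_list_pair_swap) (simp add: mult.assoc)
  also have "\<dots> = (\<Sum>(k, h2)\<leftarrow>\<Delta> h. \<Sum>(x, y)\<leftarrow>\<Delta> (g * k). S x * y * S h2)"
    by (rule sum_list_pair_cong, rule comult_mult_sum[where t = "hscale H", symmetric])
      (intro linear_intros)
  also have "\<dots> = (\<Sum>(k, h2)\<leftarrow>\<Delta> h. hscale H (\<epsilon> g) (S (hscale H (\<epsilon> k) h2)))"
    by (simp add: sum_list_pair_mult_const antipode_left counit_mult hopf.scale_mult_left
        linear_map_scale[OF antipode_linear])
  also have "\<dots> = hscale H (\<epsilon> g) (S h)"
    by (rule counit_left_sum[where t = "hscale H"])
      (intro linear_intros linear_map_comp[OF hopf.linear_scale_self])
  finally show ?thesis .
qed

lemma antipode_mult: "S (g * h) = S h * S g"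
proof -
  have "S (g * h) * 1 = (\<Sum>(g0, k)\<leftarrow>\<Delta> g. \<Sum>(g1, g2)\<leftarrow>\<Delta> k. S (g0 * h) * (g1 * S g2))"
    by (rule cancel_right[where t = "hscale H", OF cancelling_antipode_right, symmetric])
      (intro linear_intros)
  also have "\<dots> = (\<Sum>(k, g2)\<leftarrow>\<Delta> g. \<Sum>(g0, g1)\<leftarrow>\<Delta> k. S (g0 * h) * (g1 * S g2))"
    by (rule coassoc_sum[where t = "hscale H", symmetric]) (intro linear_intros)
  also have "\<dots> = (\<Sum>(k, g2)\<leftarrow>\<Delta> g. (\<Sum>(g0, g1)\<leftarrow>\<Delta> k. S (g0 * h) * g1) * S g2)"
    by (simp add: sum_list_pair_mult_const mult.assoc[symmetric])
  also have "\<dots> = (\<Sum>(k, g2)\<leftarrow>\<Delta> g. S h * S (hscale H (\<epsilon> k) g2))"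
    by (simp add: antipode_mult_cancel hopf.scale_mult_left hopf.scale_mult_right
        linear_map_scale[OF antipode_linear])
  also have "\<dots> = S h * S g"
    by (rule counit_left_sum[where t = "hscale H"]) (intro linear_intros)
  finally show ?thesis by simp
qed

lemma comult_antipode_cancel:
  assumes F: "bilinear (hscale H) (hscale H) t F"
  shows "(\<Sum>(h0, h1)\<leftarrow>\<Delta> h. \<Sum>(x, y)\<leftarrow>\<Delta> (S h0). F (x * h1) y) = F 1 (S h)"
proof -
  note lin = linear_intros bilinear_left[OF F] bilinear_right[OF F] bilinear_vector_space[OF F]
  have "(\<Sum>(h0, h1)\<leftarrow>\<Delta> h. \<Sum>(x, y)\<leftarrow>\<Delta> (S h0). F (x * h1) (y * 1)) =
      (\<Sum>(h0, k)\<leftarrow>\<Delta> h. \<Sum>(h1, l)\<leftarrow>\<Delta> k. \<Sum>(h2, h3)\<leftarrow>\<Delta> l. \<Sum>(x, y)\<leftarrow>\<Delta> (S h0). F (x * h1) (y * (h2 * S h3)))"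
    by (rule sum_list_pair_cong,
        rule cancel_right[where t = t, OF cancelling_antipode_right, symmetric])
      (intro lin)
  also have "\<dots> = (\<Sum>(h0, k)\<leftarrow>\<Delta> h. \<Sum>(l, h3)\<leftarrow>\<Delta> k. \<Sum>(h1, h2)\<leftarrow>\<Delta> l.
      \<Sum>(x, y)\<leftarrow>\<Delta> (S h0). F (x * h1) (y * (h2 * S h3)))"
    by (rule sum_list_pair_cong, rule coassoc_sum[where t = t, symmetric]) (intro lin)
  also have "\<dots> = (\<Sum>(h0, k)\<leftarrow>\<Delta> h. \<Sum>(l, h3)\<leftarrow>\<Delta> k. \<Sum>(x, y)\<leftarrow>\<Delta> (S h0 * l). F x (y * S h3))"
    by (intro sum_list_pair_cong, subst sum_list_pair_swap, subst comult_mult_sum[where t = t])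
      (simp add: mult.assoc | intro lin)+
  also have "\<dots> = (\<Sum>(x, y)\<leftarrow>\<Delta> 1. F x (y * S h))"
    by (rule cancel_left[where t = t, OF cancelling_antipode_left]) (intro lin)
  also have "\<dots> = F 1 (1 * S h)"
    by (rule comult_one_sum[where t = t]) (intro lin)
  finally show ?thesis by simp
qed

lemma comult_antipode_sum:
  assumes F: "bilinear (hscale H) (hscale H) t F"
  shows "(\<Sum>(x, y)\<leftarrow>\<Delta> (S h). F x y) = (\<Sum>(x, y)\<leftarrow>\<Delta> h. F (S y) (S x))"
proof -
  note lin = linear_intros bilinear_left[OF F] bilinear_right[OF F] bilinear_vector_space[OF F]
  have "(\<Sum>(x, y)\<leftarrow>\<Delta> (S h). F (x * 1) y) =
      (\<Sum>(h0, k)\<leftarrow>\<Delta> h. \<Sum>(h1, h2)\<leftarrow>\<Delta> k. \<Sum>(x, y)\<leftarrow>\<Delta> (S h0). F (x * (h1 * S h2)) y)"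
    by (rule cancel_right[where t = t, OF cancelling_antipode_right, symmetric]) (intro lin)
  also have "\<dots> = (\<Sum>(k, h2)\<leftarrow>\<Delta> h. \<Sum>(h0, h1)\<leftarrow>\<Delta> k. \<Sum>(x, y)\<leftarrow>\<Delta> (S h0). F (x * (h1 * S h2)) y)"
    by (rule coassoc_sum[where t = t, symmetric]) (intro lin)
  also have "\<dots> = (\<Sum>(k, h2)\<leftarrow>\<Delta> h. \<Sum>(h0, h1)\<leftarrow>\<Delta> k. \<Sum>(x, y)\<leftarrow>\<Delta> (S h0). F (x * h1 * S h2) y)"
    by (simp add: mult.assoc)
  also have "\<dots> = (\<Sum>(k, h2)\<leftarrow>\<Delta> h. F (1 * S h2) (S k))"
    by (rule sum_list_pair_cong, rule comult_antipode_cancel[where t = t]) (intro lin)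
  finally show ?thesis by simp
qed

lemma comult_conj_sum:
  assumes F: "bilinear (hscale H) (hscale H) t F"
  shows "(\<Sum>(x, y)\<leftarrow>\<Delta> (S h1 * g * h0). F x y) =
    (\<Sum>(p, x)\<leftarrow>\<Delta> h0. \<Sum>(z, y)\<leftarrow>\<Delta> h1. \<Sum>(g0, g1)\<leftarrow>\<Delta> g. F (S y * g0 * p) (S z * g1 * x))"
proof -
  note lin = linear_intros bilinear_left[OF F] bilinear_right[OF F] bilinear_vector_space[OF F]
  have "(\<Sum>(x, y)\<leftarrow>\<Delta> (S h1 * g * h0). F x y) =
      (\<Sum>(x, y)\<leftarrow>\<Delta> (S h1 * g). \<Sum>(p, q)\<leftarrow>\<Delta> h0. F (x * p) (y * q))"
    by (rule comult_mult_sum[OF F])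
  also have "\<dots> = (\<Sum>(x, y)\<leftarrow>\<Delta> (S h1). \<Sum>(g0, g1)\<leftarrow>\<Delta> g. \<Sum>(p, q)\<leftarrow>\<Delta> h0. F (x * g0 * p) (y * g1 * q))"
    by (rule comult_mult_sum[where t = t]) (intro lin)
  also have "\<dots> = (\<Sum>(z, y)\<leftarrow>\<Delta> h1. \<Sum>(g0, g1)\<leftarrow>\<Delta> g. \<Sum>(p, q)\<leftarrow>\<Delta> h0. F (S y * g0 * p) (S z * g1 * q))"
    by (rule comult_antipode_sum[where t = t]) (intro lin)
  also have "\<dots> = (\<Sum>(z, y)\<leftarrow>\<Delta> h1. \<Sum>(p, q)\<leftarrow>\<Delta> h0. \<Sum>(g0, g1)\<leftarrow>\<Delta> g. F (S y * g0 * p) (S z * g1 * q))"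
    by (intro sum_list_pair_cong sum_list_pair_swap)
  also have "\<dots> = (\<Sum>(p, q)\<leftarrow>\<Delta> h0. \<Sum>(z, y)\<leftarrow>\<Delta> h1. \<Sum>(g0, g1)\<leftarrow>\<Delta> g. F (S y * g0 * p) (S z * g1 * q))"
    by (rule sum_list_pair_swap)
  finally show ?thesis .
qed

end

locale bijective_hopf_algebra = hopf_algebra +
  assumes bij_antipode: "bij (antipode H)"
begin

abbreviation "S_inv \<equiv> inv (antipode H)"

lemma antipode_S_inv [simp]: "S (S_inv h) = h" and S_inv_antipode [simp]: "S_inv (S h) = h"
  using bij_antipode by (auto simp: bij_def surj_f_inv_f)

lemma linear_map_S_inv: "linear_map (hscale H) (hscale H) S_inv"
proof -
  have "S_inv (x + y) = S_inv x + S_inv y" for x y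
    by (metis S_inv_antipode antipode_S_inv linear_map_add[OF antipode_linear])
  moreover have "S_inv (hscale H c x) = hscale H c (S_inv x)" for c x
    by (metis S_inv_antipode antipode_S_inv linear_map_scale[OF antipode_linear])
  ultimately show ?thesis
    by (simp add: Vector_Spaces.linear_iff hopf.vector_space_axioms)
qed

lemmas [linear_intros] = linear_map_comp[OF linear_map_S_inv]

lemma cancelling_S_inv: "cancelling (\<lambda>x y. y * S_inv x)"
proof -
  have "S (\<Sum>(x, y)\<leftarrow>\<Delta> h. y * S_inv x) = S (hscale H (\<epsilon> h) 1)" for h
    by (simp add: linear_map_sum_list_pair[OF antipode_linear] antipode_mult antipode_right
        linear_map_scale[OF antipode_linear] antipode_one)
  then have "(\<Sum>(x, y)\<leftarrow>\<Delta> h. y * S_inv x) = hscale H (\<epsilon> h) 1" for h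
    by (metis S_inv_antipode)
  then show ?thesis
    by (auto simp: cancelling_def intro!: linear_intros)
qed

lemma comult_S_inv_sum:
  assumes F: "bilinear (hscale H) (hscale H) t F"
  shows "(\<Sum>(x, y)\<leftarrow>\<Delta> (S_inv h). F x y) = (\<Sum>(x, y)\<leftarrow>\<Delta> h. F (S_inv y) (S_inv x))"
proof -
  have "(\<Sum>(x, y)\<leftarrow>\<Delta> (S (S_inv h)). F (S_inv y) (S_inv x)) =
      (\<Sum>(x, y)\<leftarrow>\<Delta> (S_inv h). F (S_inv (S x)) (S_inv (S y)))"
    by (rule comult_antipode_sum[where t = t])
      (intro linear_intros bilinear_left[OF F] bilinear_right[OF F])
  then show ?thesis by simp
qed

lemma comult2_S_inv_sum:
  assumes "trilinear (hscale H) (hscale H) (hscale H) t F"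
  shows "(\<Sum>(x, k)\<leftarrow>\<Delta> (S_inv h). \<Sum>(y, z)\<leftarrow>\<Delta> k. F x y z) =
    (\<Sum>(z, k)\<leftarrow>\<Delta> h. \<Sum>(y, x)\<leftarrow>\<Delta> k. F (S_inv x) (S_inv y) (S_inv z))"
proof -
  have F: "linear_map (hscale H) t (\<lambda>x. F x y z)" "linear_map (hscale H) t (\<lambda>y. F x y z)"
    "linear_map (hscale H) t (F x y)" for x y z
    using assms by (simp_all add: trilinear_def)
  then have "vector_space t"
    by (simp add: Vector_Spaces.linear_iff)
  note lin = linear_intros this
    linear_map_comp[OF F(1)] linear_map_comp[OF F(2)] linear_map_comp[OF F(3)]
  have "(\<Sum>(x, k)\<leftarrow>\<Delta> (S_inv h). \<Sum>(y, z)\<leftarrow>\<Delta> k. F x y z) =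
      (\<Sum>(k, x)\<leftarrow>\<Delta> h. \<Sum>(y, z)\<leftarrow>\<Delta> (S_inv k). F (S_inv x) y z)"
    by (rule comult_S_inv_sum[where t = t]) (intro lin)
  also have "\<dots> = (\<Sum>(k, x)\<leftarrow>\<Delta> h. \<Sum>(z, y)\<leftarrow>\<Delta> k. F (S_inv x) (S_inv y) (S_inv z))"
    by (rule sum_list_pair_cong, rule comult_S_inv_sum[where t = t]) (intro lin)
  also have "\<dots> = (\<Sum>(z, k)\<leftarrow>\<Delta> h. \<Sum>(y, x)\<leftarrow>\<Delta> k. F (S_inv x) (S_inv y) (S_inv z))"
    by (rule coassoc_sum[where t = t]) (intro lin)
  finally show ?thesis .
qed

end

section \<open>Endomorphisms and traces\<close>

context vector_space
begin

lemma vector_space_end_scale: "vector_space (end_scale scale)"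
  by unfold_locales (auto simp: end_scale_def fun_eq_iff scale_right_distrib scale_left_distrib)

lemma id_endos: "id \<in> endos scale"
  by (simp add: endos_def linear_id)

lemma comp_endos: "u \<in> endos scale \<Longrightarrow> v \<in> endos scale \<Longrightarrow> u \<circ> v \<in> endos scale"
  by (simp add: endos_def Vector_Spaces.linear_compose)

lemma add_endos: "u \<in> endos scale \<Longrightarrow> v \<in> endos scale \<Longrightarrow> u + v \<in> endos scale"
  and zero_endos: "0 \<in> endos scale"
  and scale_endos: "u \<in> endos scale \<Longrightarrow> end_scale scale c u \<in> endos scale"
  using vector_space_axioms
  by (auto simp: endos_def Vector_Spaces.linear_iff end_scale_def scale_right_distrib
      scale_left_commute algebra_simps)

lemma linear_map_comp_left:
  "linear_map s (end_scale scale) T \<Longrightarrow> linear_map s (end_scale scale) (\<lambda>x. T x \<circ> u)"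
  by (auto simp: Vector_Spaces.linear_iff end_scale_def fun_eq_iff)

lemma linear_map_comp_right:
  "u \<in> endos scale \<Longrightarrow> linear_map s (end_scale scale) T \<Longrightarrow>
   linear_map s (end_scale scale) (\<lambda>x. u \<circ> T x)"
  by (auto simp: Vector_Spaces.linear_iff end_scale_def fun_eq_iff endos_def)

lemma trace_basis:
  assumes "finite_dim scale"
  obtains B where "independent B" "span B = UNIV" "finite B"
    "\<And>u. trace scale u = (\<Sum>b\<in>B. representation B (u b) b)"
proof -
  let ?basis = "\<lambda>B. independent B \<and> span B = UNIV"
  define B where "B = (SOME B. ?basis B)"
  obtain B' where "B' \<subseteq> UNIV" "independent B'" "UNIV \<subseteq> span B'"
    using maximal_independent_subset[of UNIV] by metis
  then have "?basis B'" by auto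
  then have B: "?basis B" unfolding B_def by (rule someI)
  obtain C where "finite C" "span C = UNIV" using assms by (auto simp: finite_dim_def)
  then have "finite B" using independent_span_bound[of C B] B by auto
  then show thesis using that[of B] B by (simp add: trace_def B_def[symmetric])
qed

lemma linear_map_trace:
  assumes "finite_dim scale"
  shows "linear_map (end_scale scale) (*) (trace scale)"
proof -
  obtain B where B: "independent B" "span B = UNIV"
    "\<And>u. trace scale u = (\<Sum>b\<in>B. representation B (u b) b)"
    using trace_basis[OF assms] by metis
  have "trace scale (u + v) = trace scale u + trace scale v" for u v
    by (simp add: B representation_add sum.distrib)
  moreover have "trace scale (end_scale scale c u) = c * trace scale u" for c u
    by (simp add: B end_scale_def representation_scale sum_distrib_left)
  ultimately show ?thesis
    using vector_space_end_scale unital_algebra.axioms(1)[OF unital_algebra_field]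
    by (simp add: Vector_Spaces.linear_iff)
qed

lemma trace_comp_commute:
  assumes "finite_dim scale" and u: "u \<in> endos scale" and v: "v \<in> endos scale"
  shows "trace scale (u \<circ> v) = trace scale (v \<circ> u)"
proof -
  obtain B where B: "independent B" "span B = UNIV" "finite B"
    "\<And>u. trace scale u = (\<Sum>b\<in>B. representation B (u b) b)"
    using trace_basis[OF assms(1)] by metis
  have trace_comp:
    "trace scale (u \<circ> v) = (\<Sum>b\<in>B. \<Sum>c\<in>B. representation B (v b) c * representation B (u c) b)"
    if u: "u \<in> endos scale" for u v
  proof -
    interpret u: Vector_Spaces.linear scale scale u using u by (simp add: endos_def)
    have "u (v b) = (\<Sum>c\<in>B. scale (representation B (v b) c) (u c))" for b
      by (subst sum_representation_eq[OF B(1) _ B(3) order_refl, of "v b", symmetric])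
        (simp_all add: B u.sum u.scale)
    then show ?thesis
      by (simp add: B representation_sum representation_scale)
  qed
  show ?thesis
    unfolding trace_comp[OF u] trace_comp[OF v] by (subst sum.swap) (simp add: mult.commute)
qed

end

section \<open>Modules and Yetter-Drinfeld algebras over a Hopf algebra\<close>

lemma length_iter_sweedler: "hs \<in> set (iter_sweedler H n h) \<Longrightarrow> length hs = Suc n"
  by (induction n arbitrary: h hs) auto

lemma sum_iter_sweedler_Suc:
  "(\<Sum>hs\<leftarrow>iter_sweedler H (Suc n) h. F hs) =
   (\<Sum>(h0, h1)\<leftarrow>sweedler H h. \<Sum>hs\<leftarrow>iter_sweedler H n h1. F (h0 # hs) :: 'z::monoid_add)"
  by (simp add: sum_list_concat_map comp_def case_prod_unfold)

sublocale hopf_module \<subseteq> vector_space scale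
  by (rule vector_space)

locale hopf_representation = hopf_algebra H + hopf_module H scale act
  for H :: "('k::field, 'h::{ring, monoid_mult}) hopf_data"
    and scale :: "'k \<Rightarrow> 'v::ab_group_add \<Rightarrow> 'v"
    and act :: "'h \<Rightarrow> 'v \<Rightarrow> 'v"
begin

lemma act_endos: "act h \<in> endos scale"
  by (simp add: endos_def act_linear)

lemma act_mult_comp: "act (g * h) = act g \<circ> act h"
  by (auto simp: act_mult)

lemma act_one_id: "act 1 = id"
  by (auto simp: act_one)

lemma linear_map_act: "linear_map (hscale H) (end_scale scale) act"
  by (simp add: Vector_Spaces.linear_iff hopf.vector_space_axioms vector_space_end_scale
      act_add act_scale end_scale_def fun_eq_iff)

lemma linear_map_act_left [linear_intros]:
  "linear_map s (hscale H) T \<Longrightarrow> linear_map s scale (\<lambda>x. act (T x) v)"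
  by (simp add: Vector_Spaces.linear_iff act_add act_scale vector_space)

lemmas [linear_intros] =
  vector_space linear_ident linear_map_comp[OF act_linear]
  vector_space_end_scale vector_space.linear_ident[OF vector_space_end_scale]
  linear_map_comp_left linear_map_comp_right linear_map_comp[OF linear_map_act]
  act_endos comp_endos

lemma end_act_endos:
  assumes "u \<in> endos scale"
  shows "end_act H act h u \<in> endos scale"
proof -
  have "(\<Sum>(x, y)\<leftarrow>xs. act x \<circ> u \<circ> act (S y)) \<in> endos scale" for xs
    using assms by (induction xs) (auto intro!: add_endos zero_endos comp_endos act_endos)
  then show ?thesis by (simp add: end_act_def)
qed

lemma linear_map_apply_end_act:
  assumes "linear_map (end_scale scale) t F"
  shows "F (end_act H act h u) = (\<Sum>(x, y)\<leftarrow>\<Delta> h. F (act x \<circ> u \<circ> act (S y)))"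
  unfolding end_act_def by (rule linear_map_sum_list_pair[OF assms])

definition diag_act :: "nat \<Rightarrow> 'h \<Rightarrow> ('v list \<Rightarrow> 'z::ab_group_add) \<Rightarrow> 'v list \<Rightarrow> 'z" where
  "diag_act n h F vs = (\<Sum>hs\<leftarrow>iter_sweedler H n h. F (map2 act hs vs))"

lemma diag_act_0: "diag_act 0 h F [v] = F [act h v]"
  by (simp add: diag_act_def)

lemma diag_act_Suc:
  "diag_act (Suc n) h F (v # vs) = (\<Sum>(h0, h1)\<leftarrow>\<Delta> h. diag_act n h1 (\<lambda>vs. F (act h0 v # vs)) vs)"
  by (simp add: diag_act_def sum_iter_sweedler_Suc del: iter_sweedler.simps)

lemma linear_map_diag_act_fun:
  assumes "length vs = Suc n" and "vector_space s" and "vector_space t"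
    and "\<And>vs. length vs = Suc n \<Longrightarrow> linear_map s t (\<lambda>x. F x vs)"
  shows "linear_map s t (\<lambda>x. diag_act n h (F x) vs)"
  unfolding diag_act_def
  by (intro linear_map_sum_list assms) (simp add: assms(1) length_iter_sweedler)

lemma linear_map_diag_act:
  assumes "multilinear scale t (Suc n) F" and "length vs = Suc n" and "vector_space t"
  shows "linear_map (hscale H) t (\<lambda>h. diag_act n h F vs)"
  using assms(1,2)
proof (induction n arbitrary: F vs)
  case 0
  then obtain v where vs: "vs = [v]" by (auto simp: length_Suc_conv)
  show ?case
    unfolding vs diag_act_0 by (intro multilinear_head[OF 0(1)] linear_intros) simp
next
  case (Suc n)
  then obtain v vs' where vs: "vs = v # vs'" and len: "length vs' = Suc n"
    by (auto simp: length_Suc_conv)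
  show ?case
    unfolding vs diag_act_Suc
    by (intro linear_intros linear_map_diag_act_fun Suc.IH multilinear_Cons
        multilinear_head[OF Suc.prems(1)] Suc.prems(1) len assms(3))
qed

end

locale yetter_drinfeld_hopf_algebra =
  bijective_hopf_algebra H + yetter_drinfeld_algebra H scale act coact
  for H :: "('k::field, 'h::{ring, monoid_mult}) hopf_data"
    and scale :: "'k \<Rightarrow> 'a::{ring, monoid_mult} \<Rightarrow> 'a"
    and act :: "'h \<Rightarrow> 'a \<Rightarrow> 'a"
    and coact :: "'a \<Rightarrow> ('a \<times> 'h) list set"
begin

sublocale hopf_representation H scale act ..

abbreviation "\<rho> a \<equiv> sw (coact a)"

lemma linear_map_coact [linear_intros]:
  assumes "linear_map s scale T"
    and "\<And>z. linear_map scale t (\<lambda>y. F y z)" and "\<And>y. linear_map (hscale H) t (F y)"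
  shows "linear_map s t (\<lambda>x. \<Sum>(y, z)\<leftarrow>\<rho> (T x). F y z)"
  by (rule linear_map_comp[OF linear_map_sum_sw[OF coact_linear bilinearI vector_space_axioms]])
    (use assms in auto)

lemmas [linear_intros] =
  linear_map_mult_left[OF unital_algebra_axioms] linear_map_mult_right[OF unital_algebra_axioms]

lemma coact_coassoc_sum:
  assumes "trilinear scale (hscale H) (hscale H) t F"
  shows "(\<Sum>(a0, a1)\<leftarrow>\<rho> a. \<Sum>(x, y)\<leftarrow>\<rho> a0. F x y a1) = (\<Sum>(a0, a1)\<leftarrow>\<rho> a. \<Sum>(x, y)\<leftarrow>\<Delta> a1. F a0 x y)"
  using tensor3_eq_imp_sum_eq[OF coact_coassoc[of a] assms]
  by (simp add: sum_list_concat_map comp_def case_prod_unfold)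

lemma coact_mult_sum:
  assumes "bilinear scale (hscale H) t F"
  shows "(\<Sum>(x, y)\<leftarrow>\<rho> (a * b). F x y) = (\<Sum>(a0, a1)\<leftarrow>\<rho> a. \<Sum>(b0, b1)\<leftarrow>\<rho> b. F (a0 * b0) (b1 * a1))"
  unfolding coact_mult
  by (subst sum_sw_tensor_class[OF assms])
    (simp_all add: sum_list_concat_map comp_def case_prod_unfold)

lemma coact_one_sum:
  assumes "bilinear scale (hscale H) t F"
  shows "(\<Sum>(x, y)\<leftarrow>\<rho> 1. F x y) = F 1 1"
  unfolding coact_one by (subst sum_sw_tensor_class[OF assms]) simp_all

lemma yetter_drinfeld_sum:
  assumes "bilinear scale (hscale H) t F"
  shows "(\<Sum>(h0, h1)\<leftarrow>\<Delta> h. \<Sum>(x, y)\<leftarrow>\<rho> (act h1 a). F x (y * h0)) =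
    (\<Sum>(h0, h1)\<leftarrow>\<Delta> h. \<Sum>(a0, a1)\<leftarrow>\<rho> a. F (act h0 a0) (h1 * a1))"
  using arg_cong[OF yetter_drinfeld[where h = h and a = a], of "\<lambda>p. \<Sum>(x, y)\<leftarrow>sw p. F x y"]
  by (simp only: sum_sw_tensor_class[OF assms] lists_UNIV UNIV_Times_UNIV UNIV_I)
    (simp add: sum_list_concat_map comp_def case_prod_unfold)

lemma coact_act_sum:
  assumes F: "bilinear scale (hscale H) t F"
  shows "(\<Sum>(x, y)\<leftarrow>\<rho> (act h a). F x y) =
    (\<Sum>(p, k)\<leftarrow>\<Delta> h. \<Sum>(q, r)\<leftarrow>\<Delta> k. \<Sum>(a0, a1)\<leftarrow>\<rho> a. F (act q a0) (r * a1 * S_inv p))"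
proof -
  note lin = linear_intros bilinear_left[OF F] bilinear_right[OF F] bilinear_vector_space[OF F]
  have "(\<Sum>(p, k)\<leftarrow>\<Delta> h. \<Sum>(q, r)\<leftarrow>\<Delta> k. \<Sum>(a0, a1)\<leftarrow>\<rho> a. F (act q a0) (r * a1 * S_inv p)) =
      (\<Sum>(p, k)\<leftarrow>\<Delta> h. \<Sum>(q, r)\<leftarrow>\<Delta> k. \<Sum>(x, y)\<leftarrow>\<rho> (act r a). F x (y * q * S_inv p))"
    by (rule sum_list_pair_cong, rule yetter_drinfeld_sum[where t = t, symmetric]) (intro lin)
  also have "\<dots> = (\<Sum>(p, k)\<leftarrow>\<Delta> h. \<Sum>(q, r)\<leftarrow>\<Delta> k. \<Sum>(x, y)\<leftarrow>\<rho> (act r a). F x (y * (q * S_inv p)))"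
    by (simp add: mult.assoc)
  also have "\<dots> = (\<Sum>(x, y)\<leftarrow>\<rho> (act h a). F x (y * 1))"
    by (rule cancel_left[where t = t, OF cancelling_S_inv]) (intro lin)
  finally show ?thesis by simp
qed

end

section \<open>The twist\<close>

locale yetter_drinfeld_coefficients =
  bijective_hopf_algebra H + A?: yetter_drinfeld_hopf_algebra H scaleA actA coact +
  V: hopf_representation H scaleV actV
  for H :: "('k::field, 'h::{ring, monoid_mult}) hopf_data"
    and scaleA :: "'k \<Rightarrow> 'a::{ring, monoid_mult} \<Rightarrow> 'a"
    and actA :: "'h \<Rightarrow> 'a \<Rightarrow> 'a"
    and coact :: "'a \<Rightarrow> ('a \<times> 'h) list set"
    and scaleV :: "'k \<Rightarrow> 'v::ab_group_add \<Rightarrow> 'v"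
    and actV :: "'h \<Rightarrow> 'v \<Rightarrow> 'v"
begin

text \<open>
  Forms are linear in all functions on \<open>V\<close>, not only in the endomorphisms. This is harmless for
  \<open>tr\<close>, but precomposition with \<open>w \<mapsto> u \<circ> w\<close> preserves it only if \<open>u\<close> is an endomorphism.
\<close>

abbreviation bilinear_form :: "('a \<Rightarrow> ('v \<Rightarrow> 'v) \<Rightarrow> 'k) \<Rightarrow> bool" where
  "bilinear_form \<equiv> bilinear scaleA (end_scale scaleV) (*)"

definition twist_form :: "('a \<Rightarrow> ('v \<Rightarrow> 'v) \<Rightarrow> 'k) \<Rightarrow> 'a \<Rightarrow> ('v \<Rightarrow> 'v) \<Rightarrow> 'k" where
  "twist_form L a u = (\<Sum>(a0, a1)\<leftarrow>\<rho> a. L a0 (actV (S a1) \<circ> u))"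

lemma bilinear_twist_form:
  assumes L: "bilinear_form L"
  shows "bilinear_form (twist_form L)"
  unfolding twist_form_def
  by (intro linear_intros bilinear_left[OF L] bilinear_right[OF L])

lemma twist_form_one:
  assumes L: "bilinear_form L"
  shows "twist_form L 1 id = L 1 id"
proof -
  have "twist_form L 1 id = L 1 (actV (S 1) \<circ> id)"
    unfolding twist_form_def
    by (rule coact_one_sum[where t = "(*)"])
      (intro linear_intros bilinear_left[OF L] bilinear_right[OF L])
  then show ?thesis by (simp add: antipode_one V.act_one_id)
qed

lemma twist_form_act:
  assumes L: "bilinear_form L" and u: "u \<in> endos scaleV"
  shows "(\<Sum>(h0, h1)\<leftarrow>\<Delta> h. twist_form L (actA h0 a) (end_act H actV h1 u)) =
    (\<Sum>(p, k)\<leftarrow>\<Delta> h. \<Sum>(q, y)\<leftarrow>\<Delta> k. twist_form (\<lambda>a w. L (actA q a) (actV p \<circ> w \<circ> actV (S y))) a u)"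
proof -
  note lin = linear_intros bilinear_left[OF L] bilinear_right[OF L] u
  define K where "K p q z y =
    (\<Sum>(a0, a1)\<leftarrow>\<rho> a. L (actA q a0) (actV p \<circ> actV (S a1) \<circ> actV z \<circ> u \<circ> actV (S y)))" for p q z y
  have "(\<Sum>(h0, h1)\<leftarrow>\<Delta> h. twist_form L (actA h0 a) (end_act H actV h1 u)) =
      (\<Sum>(h0, h1)\<leftarrow>\<Delta> h. \<Sum>(x0, x1)\<leftarrow>\<rho> (actA h0 a). \<Sum>(x, y)\<leftarrow>\<Delta> h1.
        L x0 (actV (S x1) \<circ> (actV x \<circ> u \<circ> actV (S y))))"
    unfolding twist_form_def
    by (intro sum_list_pair_cong V.linear_map_apply_end_act[where t = "(*)"]) (intro lin)
  also have "\<dots> = (\<Sum>(h0, h1)\<leftarrow>\<Delta> h. \<Sum>(p, k)\<leftarrow>\<Delta> h0. \<Sum>(q, r)\<leftarrow>\<Delta> k. \<Sum>(a0, a1)\<leftarrow>\<rho> a. \<Sum>(x, y)\<leftarrow>\<Delta> h1.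
        L (actA q a0) (actV (S (r * a1 * S_inv p)) \<circ> (actV x \<circ> u \<circ> actV (S y))))"
    by (rule sum_list_pair_cong, rule coact_act_sum[where t = "(*)"]) (intro lin)
  also have "\<dots> = (\<Sum>(h0, h1)\<leftarrow>\<Delta> h. \<Sum>(p, k)\<leftarrow>\<Delta> h0. \<Sum>(q, r)\<leftarrow>\<Delta> k. \<Sum>(x, y)\<leftarrow>\<Delta> h1. K p q (S r * x) y)"
    unfolding K_def
    by (intro sum_list_pair_cong, subst sum_list_pair_swap)
      (simp add: antipode_mult V.act_mult_comp comp_assoc)
  also have "\<dots> = (\<Sum>(p, k)\<leftarrow>\<Delta> h. \<Sum>(q, y)\<leftarrow>\<Delta> k. K p q 1 y)"
    unfolding K_def
    by (rule cancel_inner[where t = "(*)", OF cancelling_antipode_left]) (intro lin)+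
  finally show ?thesis
    by (simp add: K_def twist_form_def V.act_one_id comp_assoc)
qed

lemma twist_form_prod:
  assumes L: "bilinear_form L" and u: "u \<in> endos scaleV"
  shows "twist_form L (a * b) u =
    (\<Sum>(a0, a1)\<leftarrow>\<rho> a. \<Sum>(b0, b1)\<leftarrow>\<rho> b. L (a0 * b0) (actV (S a1) \<circ> (actV (S b1) \<circ> u)))"
proof -
  have "twist_form L (a * b) u =
      (\<Sum>(a0, a1)\<leftarrow>\<rho> a. \<Sum>(b0, b1)\<leftarrow>\<rho> b. L (a0 * b0) (actV (S (b1 * a1)) \<circ> u))"
    unfolding twist_form_def
    by (rule coact_mult_sum[where t = "(*)"])
      (intro linear_intros bilinear_left[OF L] bilinear_right[OF L] u)
  then show ?thesis
    by (simp only: antipode_mult V.act_mult_comp comp_assoc)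
qed

lemma twist_form_mult:
  assumes L: "bilinear_form L" and u: "u \<in> endos scaleV" and v: "v \<in> endos scaleV"
  shows "(\<Sum>(c0, c1)\<leftarrow>\<rho> c. twist_form L (a * c0) (end_act H actV c1 u \<circ> v)) =
    twist_form (\<lambda>a w. twist_form (\<lambda>a' w'. L (a * a') (w \<circ> w')) c v) a u"
proof -
  note lin = linear_intros bilinear_left[OF L] bilinear_right[OF L]
    bilinear_right[OF bilinear_twist_form[OF L]] u v
  define K where "K a0 a1 c0 z y =
    L (a0 * c0) (actV (S a1) \<circ> (actV z \<circ> u \<circ> actV (S y) \<circ> v))" for a0 a1 c0 z y
  have "(\<Sum>(c0, c1)\<leftarrow>\<rho> c. twist_form L (a * c0) (end_act H actV c1 u \<circ> v)) =
      (\<Sum>(c0, c1)\<leftarrow>\<rho> c. \<Sum>(p, y)\<leftarrow>\<Delta> c1. twist_form L (a * c0) (actV p \<circ> u \<circ> actV (S y) \<circ> v))"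
    by (rule sum_list_pair_cong, rule V.linear_map_apply_end_act[where t = "(*)"]) (intro lin)
  also have "\<dots> = (\<Sum>(c0, c1)\<leftarrow>\<rho> c. \<Sum>(p, y)\<leftarrow>\<Delta> c1. \<Sum>(a0, a1)\<leftarrow>\<rho> a. \<Sum>(x0, x1)\<leftarrow>\<rho> c0.
      K a0 a1 x0 (S x1 * p) y)"
    by (simp add: K_def twist_form_prod[OF L] u v V.comp_endos V.act_endos V.act_mult_comp
        comp_assoc)
  also have "\<dots> = (\<Sum>(c0, c1)\<leftarrow>\<rho> c. \<Sum>(a0, a1)\<leftarrow>\<rho> a. \<Sum>(x0, x1)\<leftarrow>\<rho> c0. \<Sum>(p, y)\<leftarrow>\<Delta> c1.
      K a0 a1 x0 (S x1 * p) y)"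
    by (rule sum_list_pair_cong, rule sum_list_pair_swap_nested[symmetric])
  also have "\<dots> = (\<Sum>(a0, a1)\<leftarrow>\<rho> a. \<Sum>(c0, c1)\<leftarrow>\<rho> c. \<Sum>(x0, x1)\<leftarrow>\<rho> c0. \<Sum>(p, y)\<leftarrow>\<Delta> c1.
      K a0 a1 x0 (S x1 * p) y)"
    by (rule sum_list_pair_swap)
  also have "\<dots> = (\<Sum>(a0, a1)\<leftarrow>\<rho> a. \<Sum>(c0, c1)\<leftarrow>\<rho> c. \<Sum>(x, k)\<leftarrow>\<Delta> c1. \<Sum>(p, y)\<leftarrow>\<Delta> k.
      K a0 a1 c0 (S x * p) y)"
    unfolding K_def
    by (rule sum_list_pair_cong, rule coact_coassoc_sum[where t = "(*)"]) (intro lin)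
  also have "\<dots> = (\<Sum>(a0, a1)\<leftarrow>\<rho> a. \<Sum>(c0, c1)\<leftarrow>\<rho> c. K a0 a1 c0 1 c1)"
    unfolding K_def
    by (intro sum_list_pair_cong cancel_left[where t = "(*)", OF cancelling_antipode_left])
      (intro lin)
  finally show ?thesis
    by (simp add: K_def twist_form_def V.act_one_id comp_assoc)
qed

definition twist :: "('a \<times> ('v \<Rightarrow> 'v)) list \<Rightarrow> ('a \<times> ('v \<Rightarrow> 'v)) list" where
  "twist xs = [(a0, actV (S a1) \<circ> u). (a, u) \<leftarrow> xs, (a0, a1) \<leftarrow> \<rho> a]"

abbreviation "End_sums \<equiv> lists (UNIV \<times> endos scaleV) :: ('a \<times> ('v \<Rightarrow> 'v)) list set"

abbreviation "End_sum_rels \<equiv> tensor_rels UNIV scaleA (endos scaleV) (end_scale scaleV)"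

abbreviation "End_sum_eq \<equiv> formal_eq (UNIV \<times> endos scaleV) End_sum_rels"

lemma sum_twist: "(\<Sum>(a, w)\<leftarrow>twist xs. L a w) = (\<Sum>(a, u)\<leftarrow>xs. twist_form L a u)"
  by (simp add: twist_def twist_form_def sum_list_concat_map comp_def case_prod_unfold)

lemma sum_twist_singletons:
  "(\<Sum>p\<leftarrow>xs. \<Sum>(a, w)\<leftarrow>twist [p]. L a w) = (\<Sum>(a, w)\<leftarrow>twist xs. L a w :: 'k)"
  unfolding sum_twist by (simp add: case_prod_unfold)

lemma twist_in_lists: "xs \<in> End_sums \<Longrightarrow> twist xs \<in> End_sums"
  by (induction xs) (auto simp: twist_def intro!: V.comp_endos V.act_endos)

lemma twist_endos: "xs \<in> End_sums \<Longrightarrow> (a, w) \<in> set (twist xs) \<Longrightarrow> w \<in> endos scaleV"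
  using twist_in_lists[of xs] by (auto simp: in_lists_conv_set)

lemma sum_twist_tensor_eq:
  assumes "End_sum_eq xs ys"
    and "bilinear_form L"
  shows "(\<Sum>(a, w)\<leftarrow>twist xs. L a w) = (\<Sum>(a, w)\<leftarrow>twist ys. L a w)"
  unfolding sum_twist by (rule tensor_eq_imp_sum_eq[OF assms(1) bilinear_twist_form[OF assms(2)]])

lemma sum_twist_end_class:
  assumes "bilinear_form L" and "xs \<in> End_sums"
  shows "(\<Sum>(a, w)\<leftarrow>twist (sw (end_class scaleA scaleV xs)). L a w) = (\<Sum>(a, u)\<leftarrow>xs. twist_form L a u)"
  unfolding sum_twist end_class_def
  by (rule sum_sw_tensor_class[OF bilinear_twist_form[OF assms(1)] assms(2)])

section \<open>The algebra \<open>A \<otimes> End(V)\<close>\<close>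

abbreviation "A_End \<equiv> end_alg H scaleA actA coact scaleV actV"

lemma car_A_End: "car A_End = end_class scaleA scaleV ` End_sums"
  by (simp add: end_alg_def end_class_def tensor_space_def)

lemma sw_car_A_End: "b \<in> car A_End \<Longrightarrow> sw b \<in> End_sums"
proof -
  have "End_sum_rels \<subseteq> End_sums \<times> End_sums"
    unfolding tensor_rels_def by (auto intro: V.add_endos V.scale_endos)
  then show "b \<in> car A_End \<Longrightarrow> sw b \<in> End_sums"
    unfolding car_A_End end_class_def
    using formal_eq_imp_lists(2)[OF formal_eq_sw_tensor_class] by blast
qed

lemma sw_car_A_End_endos: "b \<in> car A_End \<Longrightarrow> (a, u) \<in> set (sw b) \<Longrightarrow> u \<in> endos scaleV"
  using sw_car_A_End[of b] by (auto simp: in_lists_conv_set)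

lemma map_sw_End_sums: "set bs \<subseteq> car A_End \<Longrightarrow> set (map sw bs) \<subseteq> End_sums"
  using sw_car_A_End by (auto simp only: set_map)

lemma map_sw_take_End_sums: "set bs \<subseteq> car A_End \<Longrightarrow> set (map sw (take i bs)) \<subseteq> End_sums"
  using set_take_subset[of i bs] by (intro map_sw_End_sums) blast

lemma map_sw_drop_End_sums: "set bs \<subseteq> car A_End \<Longrightarrow> set (map sw (drop i bs)) \<subseteq> End_sums"
  using set_drop_subset[of i bs] by (intro map_sw_End_sums) blast

lemma unt_A_End_car: "unt A_End \<in> car A_End"
  unfolding car_A_End using V.id_endos by (auto simp: end_alg_def)

lemma sum_twist_unt:
  assumes "bilinear_form L"
  shows "(\<Sum>(a, w)\<leftarrow>twist (sw (unt A_End)). L a w) = L 1 id"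
  using sum_twist_end_class[OF assms, of "[(1, id)]"] twist_form_one[OF assms] V.id_endos
  by (simp add: end_alg_def)

lemma add_A_End_car: "b \<in> car A_End \<Longrightarrow> b' \<in> car A_End \<Longrightarrow> add A_End b b' \<in> car A_End"
  using sw_car_A_End[of b] sw_car_A_End[of b']
  by (simp add: end_alg_def tensor_add_def tensor_space_def)

lemma sum_twist_add:
  assumes "bilinear_form L" and "b \<in> car A_End" and "b' \<in> car A_End"
  shows "(\<Sum>(a, w)\<leftarrow>twist (sw (add A_End b b')). L a w) =
    (\<Sum>(a, w)\<leftarrow>twist (sw b). L a w) + (\<Sum>(a, w)\<leftarrow>twist (sw b'). L a w)"
  using sum_twist_end_class[OF assms(1), of "sw b @ sw b'"] assms(2,3)[THEN sw_car_A_End]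
  by (simp add: end_alg_def tensor_add_def end_class_def sum_twist)

lemma smul_A_End_sum: "b \<in> car A_End \<Longrightarrow> [(scaleA c a, u). (a, u) \<leftarrow> sw b] \<in> End_sums"
  by (auto simp: in_lists_conv_set dest!: sw_car_A_End_endos)

lemma smul_A_End_car: "b \<in> car A_End \<Longrightarrow> smul A_End c b \<in> car A_End"
  using smul_A_End_sum[of b c] by (simp add: end_alg_def tensor_scale_def tensor_space_def)

lemma sum_twist_smul:
  assumes L: "bilinear_form L" and b: "b \<in> car A_End"
  shows "(\<Sum>(a, w)\<leftarrow>twist (sw (smul A_End c b)). L a w) = c * (\<Sum>(a, w)\<leftarrow>twist (sw b). L a w)"
proof -
  have "(\<Sum>(a, w)\<leftarrow>twist (sw (smul A_End c b)). L a w) = (\<Sum>(a, u)\<leftarrow>sw b. twist_form L (scaleA c a) u)"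
    using sum_twist_end_class[OF L smul_A_End_sum[OF b, of c]]
    by (simp add: end_alg_def tensor_scale_def end_class_def comp_def case_prod_unfold)
  also have "\<dots> = (\<Sum>(a, u)\<leftarrow>sw b. c * twist_form L a u)"
    using bilinear_twist_form[OF L] by (simp add: bilinear_def Vector_Spaces.linear_iff)
  finally show ?thesis by (simp add: sum_list_pair_const_mult sum_twist)
qed

lemma act_A_End_sum: "b \<in> car A_End \<Longrightarrow>
    [(actA h0 a, end_act H actV h1 u). (a, u) \<leftarrow> sw b, (h0, h1) \<leftarrow> \<Delta> h] \<in> End_sums"
  by (auto simp: in_lists_conv_set dest!: sw_car_A_End_endos intro!: V.end_act_endos)

lemma act_A_End_car: "b \<in> car A_End \<Longrightarrow> act A_End h b \<in> car A_End"
  by (subst car_A_End, drule act_A_End_sum[of b h]) (simp add: end_alg_def)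

lemma sum_twist_act:
  assumes L: "bilinear_form L" and b: "b \<in> car A_End"
  shows "(\<Sum>(a, w)\<leftarrow>twist (sw (act A_End h b)). L a w) =
    (\<Sum>(p, k)\<leftarrow>\<Delta> h. \<Sum>(q, y)\<leftarrow>\<Delta> k. \<Sum>(a, w)\<leftarrow>twist (sw b). L (actA q a) (actV p \<circ> w \<circ> actV (S y)))"
proof -
  have "(\<Sum>(a, w)\<leftarrow>twist (sw (act A_End h b)). L a w) =
      (\<Sum>(a, u)\<leftarrow>sw b. \<Sum>(h0, h1)\<leftarrow>\<Delta> h. twist_form L (actA h0 a) (end_act H actV h1 u))"
    using sum_twist_end_class[OF L act_A_End_sum[OF b, of h]]
    by (simp add: end_alg_def sum_list_concat_map comp_def case_prod_unfold)
  also have "\<dots> = (\<Sum>(a, u)\<leftarrow>sw b. \<Sum>(p, k)\<leftarrow>\<Delta> h. \<Sum>(q, y)\<leftarrow>\<Delta> k.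
      twist_form (\<lambda>a w. L (actA q a) (actV p \<circ> w \<circ> actV (S y))) a u)"
    by (rule sum_list_pair_cong, rule twist_form_act[OF L sw_car_A_End_endos[OF b]])
  also have "\<dots> = (\<Sum>(p, k)\<leftarrow>\<Delta> h. \<Sum>(q, y)\<leftarrow>\<Delta> k. \<Sum>(a, u)\<leftarrow>sw b.
      twist_form (\<lambda>a w. L (actA q a) (actV p \<circ> w \<circ> actV (S y))) a u)"
    by (rule sum_list_pair_swap_nested[symmetric])
  finally show ?thesis by (simp add: sum_twist)
qed

lemma mul_A_End_sum: "b \<in> car A_End \<Longrightarrow> b' \<in> car A_End \<Longrightarrow>
    [(a * c0, end_act H actV c1 u \<circ> v). (a, u) \<leftarrow> sw b, (c, v) \<leftarrow> sw b', (c0, c1) \<leftarrow> \<rho> c] \<in> End_sums"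
  by (auto simp: in_lists_conv_set dest!: sw_car_A_End_endos)
    (fold comp_def, intro V.comp_endos V.end_act_endos)

lemma mul_A_End_car: "b \<in> car A_End \<Longrightarrow> b' \<in> car A_End \<Longrightarrow> mul A_End b b' \<in> car A_End"
  by (subst car_A_End, drule (1) mul_A_End_sum[of b b']) (simp add: end_alg_def)

lemma sum_twist_mul:
  assumes L: "bilinear_form L" and b: "b \<in> car A_End" and b': "b' \<in> car A_End"
  shows "(\<Sum>(a, w)\<leftarrow>twist (sw (mul A_End b b')). L a w) =
    (\<Sum>(a, w)\<leftarrow>twist (sw b). \<Sum>(a', w')\<leftarrow>twist (sw b'). L (a * a') (w \<circ> w'))"
proof -
  have "(\<Sum>(a, w)\<leftarrow>twist (sw (mul A_End b b')). L a w) =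
      (\<Sum>(a, u)\<leftarrow>sw b. \<Sum>(c, v)\<leftarrow>sw b'. \<Sum>(c0, c1)\<leftarrow>\<rho> c. twist_form L (a * c0) (end_act H actV c1 u \<circ> v))"
    using sum_twist_end_class[OF L mul_A_End_sum[OF b b']]
    by (simp add: end_alg_def sum_list_concat_map comp_def case_prod_unfold)
  also have "\<dots> = (\<Sum>(a, u)\<leftarrow>sw b. \<Sum>(c, v)\<leftarrow>sw b'.
      twist_form (\<lambda>a w. twist_form (\<lambda>a' w'. L (a * a') (w \<circ> w')) c v) a u)"
    by (intro sum_list_pair_cong twist_form_mult[OF L] sw_car_A_End_endos[OF b]
        sw_car_A_End_endos[OF b'])
  also have "\<dots> = (\<Sum>(a, u)\<leftarrow>sw b. twist_form (\<lambda>a w. \<Sum>(c, v)\<leftarrow>sw b'.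
      twist_form (\<lambda>a' w'. L (a * a') (w \<circ> w')) c v) a u)"
    unfolding twist_form_def by (intro sum_list_pair_cong sum_list_pair_swap)
  finally show ?thesis by (simp add: sum_twist)
qed

end

section \<open>Words in \<open>A \<otimes> End(V)\<close>\<close>

lemma sum_list_product_lists_Cons:
  "(\<Sum>ys\<leftarrow>product_lists (xs # xss). F ys) =
   (\<Sum>x\<leftarrow>xs. \<Sum>ys\<leftarrow>product_lists xss. F (x # ys) :: 'z::monoid_add)"
  by (simp add: sum_list_concat_map comp_def)

context yetter_drinfeld_coefficients
begin

primrec twisted_words :: "('a \<times> ('v \<Rightarrow> 'v)) list list \<Rightarrow> ('a list \<times> ('v \<Rightarrow> 'v)) list" where
  "twisted_words [] = [([], id)]"
| "twisted_words (xs # xss) = [(a # as, w \<circ> u). (a, w) \<leftarrow> twist xs, (as, u) \<leftarrow> twisted_words xss]"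

lemma sum_twisted_words_Cons:
  "(\<Sum>(as, w)\<leftarrow>twisted_words (xs # xss). G as w) =
   (\<Sum>(a, w)\<leftarrow>twist xs. \<Sum>(as, u)\<leftarrow>twisted_words xss. G (a # as) (w \<circ> u) :: 'k)"
  by (simp add: sum_list_concat_map case_prod_unfold) (simp add: comp_def)

lemma sum_twisted_words_append:
  "(\<Sum>(as, w)\<leftarrow>twisted_words (xss @ yss). G as w) =
   (\<Sum>(as, u)\<leftarrow>twisted_words xss. \<Sum>(bs, v)\<leftarrow>twisted_words yss. G (as @ bs) (u \<circ> v) :: 'k)"
proof (induction xss arbitrary: G)
  case Nil
  show ?case by simp
next
  case (Cons xs xss)
  show ?case
    by (simp only: append_Cons sum_twisted_words_Cons Cons.IH comp_assoc)
qed

lemma sum_twisted_words_slot: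
  "(\<Sum>(as, w)\<leftarrow>twisted_words (xss @ xs # yss). G as w) =
   (\<Sum>(a, w)\<leftarrow>twist xs. \<Sum>(as, u)\<leftarrow>twisted_words xss. \<Sum>(bs, v)\<leftarrow>twisted_words yss.
     G (as @ a # bs) (u \<circ> (w \<circ> v)) :: 'k)"
  unfolding sum_twisted_words_append sum_twisted_words_Cons by (rule sum_list_pair_swap)

lemma twisted_words_mem:
  assumes "set xss \<subseteq> End_sums" and "(as, w) \<in> set (twisted_words xss)"
  shows "length as = length xss \<and> w \<in> endos scaleV"
  using assms
proof (induction xss arbitrary: as w)
  case Nil
  then show ?case by (simp add: endos_def V.linear_ident)
next
  case (Cons xs xss)
  then obtain a as' v u where eq: "as = a # as'" "w = v \<circ> u"
    and a: "(a, v) \<in> set (twist xs)" and as': "(as', u) \<in> set (twisted_words xss)"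
    by (auto simp: comp_def)
  have "v \<in> endos scaleV"
    using Cons.prems a by (intro twist_endos[of xs]) simp_all
  moreover have "length as' = length xss \<and> u \<in> endos scaleV"
    using Cons.IH[OF _ as'] Cons.prems by simp
  ultimately show ?case
    unfolding eq by (intro conjI V.comp_endos) simp_all
qed

lemma sum_product_lists_eq_sum_twisted_words:
  "(\<Sum>xs\<leftarrow>product_lists (map (\<lambda>(a, u). \<rho> a) aus).
      G (map fst xs) (foldr (\<circ>) (map2 (\<lambda>(a0, a1) (a, u). actV (S a1) \<circ> u) xs aus) v)) =
   (\<Sum>(as, w)\<leftarrow>twisted_words (map (\<lambda>p. [p]) aus). G as (w \<circ> v) :: 'k)"
proof (induction aus arbitrary: G)
  case Nil
  show ?case by simp
next
  case (Cons p aus)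
  obtain a u where p: "p = (a, u)" by (cases p)
  let ?choices = "product_lists (map (\<lambda>(a, u). \<rho> a) aus)"
  let ?prod = "\<lambda>xs. foldr (\<circ>) (map2 (\<lambda>(a0, a1) (a, u). actV (S a1) \<circ> u) xs aus) v"
  have "(\<Sum>xs\<leftarrow>product_lists (map (\<lambda>(a, u). \<rho> a) (p # aus)).
        G (map fst xs) (foldr (\<circ>) (map2 (\<lambda>(a0, a1) (a, u). actV (S a1) \<circ> u) xs (p # aus)) v)) =
      (\<Sum>(a0, a1)\<leftarrow>\<rho> a. \<Sum>xs\<leftarrow>?choices. G (a0 # map fst xs) (actV (S a1) \<circ> u \<circ> ?prod xs))"
    by (simp add: p sum_list_product_lists_Cons case_prod_unfold del: product_lists.simps)
  also have "\<dots> = (\<Sum>(a0, a1)\<leftarrow>\<rho> a. \<Sum>(as, w)\<leftarrow>twisted_words (map (\<lambda>p. [p]) aus).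
      G (a0 # as) (actV (S a1) \<circ> u \<circ> (w \<circ> v)))"
    by (rule sum_list_pair_cong, rule Cons.IH[of "\<lambda>as w. G (_ # as) (_ \<circ> w)"])
  also have "\<dots> = (\<Sum>(as, w)\<leftarrow>twisted_words (map (\<lambda>p. [p]) (p # aus)). G as (w \<circ> v))"
    by (simp add: p sum_twisted_words_Cons sum_twist twist_form_def comp_assoc
        del: twisted_words.simps)
  finally show ?case .
qed

lemma sum_product_lists_twisted_words_singletons:
  "(\<Sum>aus\<leftarrow>product_lists xss. \<Sum>(as, w)\<leftarrow>twisted_words (map (\<lambda>p. [p]) aus). G as w) =
   (\<Sum>(as, w)\<leftarrow>twisted_words xss. G as w :: 'k)"
proof (induction xss arbitrary: G)
  case Nil
  show ?case by simp
next
  case (Cons xs xss)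
  show ?case
    unfolding sum_list_product_lists_Cons list.map sum_twisted_words_Cons
      sum_list_pair_swap_list[symmetric] Cons.IH
    by (rule sum_twist_singletons)
qed

definition word_form :: "nat \<Rightarrow> ('a list \<Rightarrow> ('v \<Rightarrow> 'v) \<Rightarrow> 'k) \<Rightarrow> bool" where
  "word_form n G \<longleftrightarrow> (\<forall>w. multilinear scaleA (*) n (\<lambda>as. G as w)) \<and>
     (\<forall>as. length as = n \<longrightarrow> linear_map (end_scale scaleV) (*) (G as))"

lemma word_form_multilinear: "word_form n G \<Longrightarrow> multilinear scaleA (*) n (\<lambda>as. G as w)"
  by (simp add: word_form_def)

lemma word_form_linear:
  "word_form n G \<Longrightarrow> length as = n \<Longrightarrow> linear_map s (end_scale scaleV) T \<Longrightarrow>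
   linear_map s (*) (\<lambda>x. G as (T x))"
  by (rule linear_map_comp[where G = "G as"]) (simp_all add: word_form_def)

lemma word_form_Cons:
  assumes G: "word_form (Suc n) G" and "w \<in> endos scaleV"
  shows "word_form n (\<lambda>as u. G (a # as) (w \<circ> u))"
  unfolding word_form_def
  by (intro conjI allI impI multilinear_Cons word_form_multilinear[OF G] word_form_linear[OF G]
      linear_intros assms) simp

lemma word_form_comp_left:
  assumes G: "word_form n G" and "v \<in> endos scaleV"
  shows "word_form n (\<lambda>as w. G as (v \<circ> w))"
  unfolding word_form_def
  by (intro conjI allI impI word_form_multilinear[OF G] word_form_linear[OF G] linear_intros assms)

lemma bilinear_form_slot:
  assumes G: "word_form (length xss + length yss + 1) G"
    and xss: "set xss \<subseteq> End_sums" and yss: "set yss \<subseteq> End_sums"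
  shows "bilinear_form (\<lambda>a w. \<Sum>(as, u)\<leftarrow>twisted_words xss. \<Sum>(bs, v)\<leftarrow>twisted_words yss.
    G (as @ a # bs) (u \<circ> (w \<circ> v)))"
  by (intro linear_intros multilinear_slot[OF word_form_multilinear[OF G]] word_form_linear[OF G])
    (simp_all add: twisted_words_mem[OF xss] twisted_words_mem[OF yss])

lemma sum_twisted_words_tensor_eq:
  assumes "list_all2 End_sum_eq xss yss"
    and "set xss \<subseteq> End_sums" and "set yss \<subseteq> End_sums" and "word_form (length xss) G"
  shows "(\<Sum>(as, w)\<leftarrow>twisted_words xss. G as w) = (\<Sum>(as, w)\<leftarrow>twisted_words yss. G as w)"
  using assms
proof (induction arbitrary: G rule: list_all2_induct)
  case Nil
  show ?case by simp
next
  case (Cons xs xss ys yss)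
  note G = \<open>word_form (length (xs # xss)) G\<close>
  have "(\<Sum>(a, w)\<leftarrow>twist xs. \<Sum>(as, u)\<leftarrow>twisted_words xss. G (a # as) (w \<circ> u)) =
      (\<Sum>(a, w)\<leftarrow>twist xs. \<Sum>(as, u)\<leftarrow>twisted_words yss. G (a # as) (w \<circ> u))"
    by (intro sum_list_pair_cong Cons.IH word_form_Cons twist_endos[of xs])
      (use Cons.prems in simp_all)
  also have "\<dots> = (\<Sum>(a, w)\<leftarrow>twist ys. \<Sum>(as, u)\<leftarrow>twisted_words yss. G (a # as) (w \<circ> u))"
    using bilinear_form_slot[of "[]" yss G] Cons.prems Cons.hyps
    by (intro sum_twist_tensor_eq) (simp_all add: list_all2_lengthD)
  finally show ?case by (simp only: sum_twisted_words_Cons)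
qed

lemma sum_twisted_words_unt:
  assumes G: "word_form (length xss + length yss + 1) G"
    and xss: "set xss \<subseteq> End_sums" and yss: "set yss \<subseteq> End_sums"
  shows "(\<Sum>(as, w)\<leftarrow>twisted_words (xss @ sw (unt A_End) # yss). G as w) =
    (\<Sum>(as, w)\<leftarrow>twisted_words (xss @ yss). G (take (length xss) as @ 1 # drop (length xss) as) w)"
proof -
  have "(\<Sum>(as, w)\<leftarrow>twisted_words (xss @ sw (unt A_End) # yss). G as w) =
      (\<Sum>(as, u)\<leftarrow>twisted_words xss. \<Sum>(bs, v)\<leftarrow>twisted_words yss. G (as @ 1 # bs) (u \<circ> (id \<circ> v)))"
    unfolding sum_twisted_words_slot by (rule sum_twist_unt[OF bilinear_form_slot[OF G xss yss]])
  also have "\<dots> = (\<Sum>(as, u)\<leftarrow>twisted_words xss. \<Sum>(bs, v)\<leftarrow>twisted_words yss.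
      G (take (length xss) (as @ bs) @ 1 # drop (length xss) (as @ bs)) (u \<circ> v))"
    by (intro sum_list_pair_cong) (simp add: twisted_words_mem[OF xss])
  finally show ?thesis
    by (simp only: sum_twisted_words_append)
qed

lemma sum_twisted_words_mul:
  assumes G: "word_form (length xss + length yss + 1) G"
    and xss: "set xss \<subseteq> End_sums" and yss: "set yss \<subseteq> End_sums"
    and b: "b \<in> car A_End" and b': "b' \<in> car A_End" and i: "i = length xss"
  shows "(\<Sum>(as, w)\<leftarrow>twisted_words (xss @ sw (mul A_End b b') # yss). G as w) =
    (\<Sum>(as, w)\<leftarrow>twisted_words (xss @ sw b # sw b' # yss).
      G (take i as @ as ! i * as ! (i + 1) # drop (i + 2) as) w)"
proof -
  have "(\<Sum>(as, w)\<leftarrow>twisted_words (xss @ sw (mul A_End b b') # yss). G as w) =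
      (\<Sum>(a, w)\<leftarrow>twist (sw b). \<Sum>(a', w')\<leftarrow>twist (sw b').
        \<Sum>(as, u)\<leftarrow>twisted_words xss. \<Sum>(bs, v)\<leftarrow>twisted_words yss.
          G (as @ (a * a') # bs) (u \<circ> ((w \<circ> w') \<circ> v)))"
    unfolding sum_twisted_words_slot
    by (rule sum_twist_mul[OF bilinear_form_slot[OF G xss yss] b b'])
  also have "\<dots> = (\<Sum>(a, w)\<leftarrow>twist (sw b). \<Sum>(as, u)\<leftarrow>twisted_words xss.
        \<Sum>(a', w')\<leftarrow>twist (sw b'). \<Sum>(bs, v)\<leftarrow>twisted_words yss.
          G (as @ (a * a') # bs) (u \<circ> ((w \<circ> w') \<circ> v)))"
    by (intro sum_list_pair_cong sum_list_pair_swap)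
  also have "\<dots> = (\<Sum>(a, w)\<leftarrow>twist (sw b). \<Sum>(as, u)\<leftarrow>twisted_words xss.
        \<Sum>(a', w')\<leftarrow>twist (sw b'). \<Sum>(bs, v)\<leftarrow>twisted_words yss.
          (\<lambda>as. G (take i as @ as ! i * as ! (i + 1) # drop (i + 2) as)) (as @ a # a' # bs)
            (u \<circ> (w \<circ> (w' \<circ> v))))"
    by (intro sum_list_pair_cong) (simp add: twisted_words_mem[OF xss] i nth_append comp_assoc)
  finally show ?thesis
    by (simp only: sum_twisted_words_slot sum_twisted_words_Cons)
qed

lemma sum_twisted_words_mul_nth:
  assumes G: "word_form n G" and bs: "set bs \<subseteq> car A_End" and len: "length bs = Suc n"
    and i: "i < n"
  shows "(\<Sum>(as, w)\<leftarrow>twisted_words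
        (map sw (take i bs @ mul A_End (bs ! i) (bs ! (i + 1)) # drop (i + 2) bs)). G as w) =
    (\<Sum>(as, w)\<leftarrow>twisted_words (map sw bs). G (take i as @ as ! i * as ! (i + 1) # drop (i + 2) as) w)"
proof -
  let ?xss = "map sw (take i bs)" and ?yss = "map sw (drop (i + 2) bs)"
  have "bs = take i bs @ bs ! i # bs ! (i + 1) # drop (i + 2) bs"
    using len i by (simp add: Cons_nth_drop_Suc id_take_nth_drop)
  from arg_cong[OF this, of "map sw"]
  have "map sw bs = ?xss @ sw (bs ! i) # sw (bs ! (i + 1)) # ?yss" by simp
  moreover have "set ?xss \<subseteq> End_sums" "set ?yss \<subseteq> End_sums"
    by (fact map_sw_take_End_sums[OF bs] map_sw_drop_End_sums[OF bs])+
  moreover have "bs ! i \<in> car A_End" "bs ! (i + 1) \<in> car A_End"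
    using bs len i by (auto intro: subsetD[OF bs nth_mem])
  ultimately show ?thesis
    using sum_twisted_words_mul[of ?xss ?yss G "bs ! i" "bs ! (i + 1)" i] G len i by simp
qed

section \<open>The action on words\<close>

text \<open>
  The action on the first letter ends in \<open>S(h\<^sub>2)\<close>, which absorbs the operator \<open>h\<^sub>3\<close> in front of the
  next letter.
\<close>

lemma sum_twist_act_absorb:
  assumes T: "\<And>r. bilinear_form (\<lambda>a w. T a w r)"
    and T_lin: "\<And>a w. w \<in> endos scaleV \<Longrightarrow> linear_map (hscale H) (*) (T a w)"
    and b: "b \<in> car A_End"
  shows "(\<Sum>(h0, h1)\<leftarrow>\<Delta> h. \<Sum>(a, w)\<leftarrow>twist (sw (act A_End h0 b)). \<Sum>(x, r)\<leftarrow>\<Delta> h1. T a (w \<circ> actV x) r) =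
    (\<Sum>(p, k)\<leftarrow>\<Delta> h. \<Sum>(q, r)\<leftarrow>\<Delta> k. \<Sum>(a, w)\<leftarrow>twist (sw b). T (actA q a) (actV p \<circ> w) r)"
proof -
  note lin = linear_intros bilinear_left[OF T] bilinear_right[OF T] linear_map_comp[OF T_lin]
  define K where "K p q z r =
    (\<Sum>(a, w)\<leftarrow>twist (sw b). T (actA q a) (actV p \<circ> w \<circ> actV z) r)" for p q z r
  have "(\<Sum>(h0, h1)\<leftarrow>\<Delta> h. \<Sum>(a, w)\<leftarrow>twist (sw (act A_End h0 b)). \<Sum>(x, r)\<leftarrow>\<Delta> h1. T a (w \<circ> actV x) r) =
      (\<Sum>(h0, h1)\<leftarrow>\<Delta> h. \<Sum>(p, k)\<leftarrow>\<Delta> h0. \<Sum>(q, y)\<leftarrow>\<Delta> k. \<Sum>(a, w)\<leftarrow>twist (sw b). \<Sum>(x, r)\<leftarrow>\<Delta> h1.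
        T (actA q a) (actV p \<circ> w \<circ> actV (S y) \<circ> actV x) r)"
    by (rule sum_list_pair_cong, rule sum_twist_act[OF _ b]) (intro lin)
  also have "\<dots> = (\<Sum>(h0, h1)\<leftarrow>\<Delta> h. \<Sum>(p, k)\<leftarrow>\<Delta> h0. \<Sum>(q, y)\<leftarrow>\<Delta> k. \<Sum>(x, r)\<leftarrow>\<Delta> h1. K p q (S y * x) r)"
    unfolding K_def
    by (intro sum_list_pair_cong, subst sum_list_pair_swap) (simp add: V.act_mult_comp comp_assoc)
  also have "\<dots> = (\<Sum>(p, k)\<leftarrow>\<Delta> h. \<Sum>(q, r)\<leftarrow>\<Delta> k. K p q 1 r)"
    unfolding K_def
    by (rule cancel_inner[where t = "(*)", OF cancelling_antipode_left])
      (intro lin twist_endos[OF sw_car_A_End[OF b]]; assumption)+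
  finally show ?thesis
    by (simp add: K_def V.act_one_id)
qed

definition act_words_right ::
    "nat \<Rightarrow> ('a \<times> ('v \<Rightarrow> 'v)) list set list \<Rightarrow> ('a list \<Rightarrow> ('v \<Rightarrow> 'v) \<Rightarrow> 'k) \<Rightarrow> 'h \<Rightarrow> 'k" where
  "act_words_right n bs G h = (\<Sum>(q, y)\<leftarrow>\<Delta> h. \<Sum>(as, w)\<leftarrow>twisted_words (map sw bs).
    diag_act n q (\<lambda>as. G as (w \<circ> actV (S y))) as)"

lemma linear_map_act_words_right:
  assumes G: "word_form (Suc n) G" and len: "length bs = Suc n" and bs: "set bs \<subseteq> car A_End"
  shows "linear_map (hscale H) (*) (act_words_right n bs G)"
  unfolding act_words_right_def[abs_def]
  by (intro linear_intros linear_map_diag_act linear_map_diag_act_fun word_form_multilinear[OF G]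
      word_form_linear[OF G])
    (simp_all add: len twisted_words_mem[OF map_sw_End_sums[OF bs]])

lemma bilinear_form_act_words_right:
  assumes G: "word_form (Suc (Suc n)) G" and len: "length bs = Suc n" and bs: "set bs \<subseteq> car A_End"
  shows "bilinear_form (\<lambda>a w. act_words_right n bs (\<lambda>as u. G (a # as) (w \<circ> u)) h)"
  unfolding act_words_right_def
  by (intro linear_intros linear_map_diag_act_fun multilinear_head[OF word_form_multilinear[OF G]]
      word_form_linear[OF G])
    (simp_all add: len twisted_words_mem[OF map_sw_End_sums[OF bs]])

lemma act_words_right_Cons:
  assumes G: "word_form (Suc (Suc n)) G" and b: "b \<in> car A_End"
    and len: "length bs = Suc n" and bs: "set bs \<subseteq> car A_End"
  shows "act_words_right (Suc n) (b # bs) G h = (\<Sum>(q, r)\<leftarrow>\<Delta> h. \<Sum>(a, w)\<leftarrow>twist (sw b).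
    act_words_right n bs (\<lambda>as u. G (actA q a # as) (w \<circ> u)) r)"
proof -
  note lin = linear_intros linear_map_diag_act linear_map_diag_act_fun
    multilinear_head[OF word_form_multilinear[OF G]]
    multilinear_Cons[OF word_form_multilinear[OF G]] word_form_linear[OF G]
  let ?words = "twisted_words (map sw bs)"
  let ?term = "\<lambda>q0 q1 y a w as u.
    diag_act n q1 (\<lambda>as. G (actA q0 a # as) (w \<circ> (u \<circ> actV (S y)))) as"
  have "act_words_right (Suc n) (b # bs) G h =
      (\<Sum>(q, y)\<leftarrow>\<Delta> h. \<Sum>(a, w)\<leftarrow>twist (sw b). \<Sum>(as, u)\<leftarrow>?words. \<Sum>(q0, q1)\<leftarrow>\<Delta> q. ?term q0 q1 y a w as u)"
    by (simp only: act_words_right_def list.map sum_twisted_words_Cons diag_act_Suc comp_assoc)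
  also have "\<dots> = (\<Sum>(q, y)\<leftarrow>\<Delta> h. \<Sum>(q0, q1)\<leftarrow>\<Delta> q. \<Sum>(a, w)\<leftarrow>twist (sw b). \<Sum>(as, u)\<leftarrow>?words.
      ?term q0 q1 y a w as u)"
    by (rule sum_list_pair_cong, rule sum_list_pair_swap_nested)
  also have "\<dots> = (\<Sum>(q0, r)\<leftarrow>\<Delta> h. \<Sum>(q1, y)\<leftarrow>\<Delta> r. \<Sum>(a, w)\<leftarrow>twist (sw b). \<Sum>(as, u)\<leftarrow>?words.
      ?term q0 q1 y a w as u)"
    by (rule coassoc_sum[where t = "(*)"])
      (intro lin; simp add: len twisted_words_mem[OF map_sw_End_sums[OF bs]]
        twist_endos[OF sw_car_A_End[OF b]])
  also have "\<dots> = (\<Sum>(q0, r)\<leftarrow>\<Delta> h. \<Sum>(a, w)\<leftarrow>twist (sw b). \<Sum>(q1, y)\<leftarrow>\<Delta> r. \<Sum>(as, u)\<leftarrow>?words.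
      ?term q0 q1 y a w as u)"
    by (intro sum_list_pair_cong sum_list_pair_swap)
  finally show ?thesis
    by (simp only: act_words_right_def)
qed

lemma sum_twisted_words_act_Cons:
  "(\<Sum>hs\<leftarrow>iter_sweedler H (Suc n) h.
      \<Sum>(as, w)\<leftarrow>twisted_words (map sw (map2 (act A_End) hs (b # bs))). G as w) =
   (\<Sum>(h0, h1)\<leftarrow>\<Delta> h. \<Sum>(a, w)\<leftarrow>twist (sw (act A_End h0 b)). \<Sum>hs\<leftarrow>iter_sweedler H n h1.
      \<Sum>(as, u)\<leftarrow>twisted_words (map sw (map2 (act A_End) hs bs)). G (a # as) (w \<circ> u) :: 'k)"
  by (simp only: sum_iter_sweedler_Suc list.map zip_Cons_Cons prod.case sum_twisted_words_Cons
      sum_list_pair_swap_list[symmetric])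

lemma sum_twisted_words_act:
  assumes "word_form (Suc n) G" and "length bs = Suc n" and "set bs \<subseteq> car A_End"
  shows "(\<Sum>hs\<leftarrow>iter_sweedler H n h.
      \<Sum>(as, w)\<leftarrow>twisted_words (map sw (map2 (act A_End) hs bs)). G as w) =
    (\<Sum>(p, k)\<leftarrow>\<Delta> h. act_words_right n bs (\<lambda>as w. G as (actV p \<circ> w)) k)"
  using assms
proof (induction n arbitrary: G bs h)
  case 0
  then obtain b where bs: "bs = [b]" and b: "b \<in> car A_End" by (auto simp: length_Suc_conv)
  have "bilinear_form (\<lambda>a w. G [a] w)"
    using bilinear_form_slot[of "[]" "[]" G] 0 by simp
  from sum_twist_act[OF this b] show ?case
    by (simp add: bs act_words_right_def sum_twisted_words_Cons diag_act_0 comp_def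
        del: twisted_words.simps(2))
next
  case (Suc n)
  note G = Suc.prems(1)
  obtain b bs' where bs: "bs = b # bs'" and b: "b \<in> car A_End" and bs': "set bs' \<subseteq> car A_End"
    and len: "length bs' = Suc n"
    using Suc.prems by (auto simp: length_Suc_conv)
  define T where "T a w = act_words_right n bs' (\<lambda>as u. G (a # as) (w \<circ> u))" for a w
  have "(\<Sum>(h0, h1)\<leftarrow>\<Delta> h. \<Sum>(a, w)\<leftarrow>twist (sw (act A_End h0 b)). \<Sum>hs\<leftarrow>iter_sweedler H n h1.
        \<Sum>(as, u)\<leftarrow>twisted_words (map sw (map2 (act A_End) hs bs')). G (a # as) (w \<circ> u)) =
      (\<Sum>(h0, h1)\<leftarrow>\<Delta> h. \<Sum>(a, w)\<leftarrow>twist (sw (act A_End h0 b)).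
        \<Sum>(x, r)\<leftarrow>\<Delta> h1. T a (w \<circ> actV x) r)"
  proof (intro sum_list_pair_cong)
    fix h0 h1 a w assume "(a, w) \<in> set (twist (sw (act A_End h0 b)))"
    then have "w \<in> endos scaleV"
      by (rule twist_endos[OF sw_car_A_End[OF act_A_End_car[OF b]]])
    from Suc.IH[OF word_form_Cons[OF G this, of a] len bs', of h1]
    show "(\<Sum>hs\<leftarrow>iter_sweedler H n h1. \<Sum>(as, u)\<leftarrow>twisted_words (map sw (map2 (act A_End) hs bs')).
        G (a # as) (w \<circ> u)) = (\<Sum>(x, r)\<leftarrow>\<Delta> h1. T a (w \<circ> actV x) r)"
      by (simp only: T_def comp_assoc)
  qed
  also have "\<dots> = (\<Sum>(p, k)\<leftarrow>\<Delta> h. \<Sum>(q, r)\<leftarrow>\<Delta> k. \<Sum>(a, w)\<leftarrow>twist (sw b). T (actA q a) (actV p \<circ> w) r)"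
    unfolding T_def
    by (intro sum_twist_act_absorb b bilinear_form_act_words_right linear_map_act_words_right
        word_form_Cons G len bs')
  also have "\<dots> = (\<Sum>(p, k)\<leftarrow>\<Delta> h. act_words_right (Suc n) (b # bs') (\<lambda>as w. G as (actV p \<circ> w)) k)"
    by (simp only: T_def act_words_right_Cons[OF word_form_comp_left[OF G V.act_endos] b len bs']
        comp_assoc)
  finally show ?case
    unfolding bs sum_twisted_words_act_Cons .
qed

end

section \<open>The map \<open>\<Psi>\<close>\<close>

lemma multilinear_cochain_type_alg_iff:
  fixes scale :: "'k::field \<Rightarrow> 'a::{ring, monoid_mult} \<Rightarrow> 'a"
  assumes "unital_algebra scale"
  shows "multilinear_cochain H (type_alg scale ac) n f \<longleftrightarrow>
    (\<forall>as. length as \<noteq> Suc n \<longrightarrow> f as = (\<lambda>g. 0)) \<and>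
    (\<forall>as. length as = Suc n \<longrightarrow> linear_map (hscale H) (*) (f as)) \<and>
    (\<forall>g. multilinear scale (*) (Suc n) (\<lambda>as. f as g))"
proof -
  have spaces: "vector_space scale" "vector_space ((*) :: 'k \<Rightarrow> 'k \<Rightarrow> 'k)"
    using assms unital_algebra_field by (auto simp: unital_algebra_def)
  have "(\<forall>as\<in>tuples (type_alg scale ac) (n + 1). \<forall>i\<le>n. P (take i as) (drop (Suc i) as)) \<longleftrightarrow>
      (\<forall>as bs. length as + length bs + 1 = Suc n \<longrightarrow> P as bs)" for P
  proof (intro iffI allI impI ballI)
    fix as bs :: "'a list"
    assume P: "\<forall>as\<in>tuples (type_alg scale ac) (n + 1). \<forall>i\<le>n. P (take i as) (drop (Suc i) as)"
      and "length as + length bs + 1 = Suc n"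
    then show "P as bs"
      using P[rule_format, of "as @ 0 # bs" "length as"] by (simp add: tuples_def type_alg_def)
  qed (auto simp: tuples_def)
  note slots = this[symmetric]
  show ?thesis
    unfolding multilinear_def slots
    by (auto simp: multilinear_cochain_def tuples_def type_alg_def Vector_Spaces.linear_iff spaces
        upd_conv_take_nth_drop)
qed

lemma coface_last:
  assumes "\<And>h b. b \<in> car X \<Longrightarrow> act X h b \<in> car X"
  shows "coface H X (Suc n) (Suc n) f = cyclic_op H X (Suc n) (coface H X (Suc n) 0 f)"
proof (intro ext)
  fix as g
  show "coface H X (Suc n) (Suc n) f as g = cyclic_op H X (Suc n) (coface H X (Suc n) 0 f) as g"
  proof (cases "as \<in> tuples X (Suc n + 1)")
    case False
    then show ?thesis by (simp add: coface_def cyclic_op_def)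
  next
    case True
    then obtain a bs where "as = a # bs" and "length bs = Suc n"
      by (auto simp: tuples_def length_Suc_conv)
    then obtain cs b where as: "as = a # cs @ [b]" and len: "length cs = n"
      by (cases bs rule: rev_cases) auto
    have "act X h b # a # cs \<in> tuples X (Suc n + 1)" for h
      using True assms by (auto simp: as tuples_def)
    then have "coface H X (Suc n) 0 f (act X h b # a # cs) = f (mul X (act X h b) a # cs)" for h
      by (intro ext) (simp add: coface_def)
    then show ?thesis
      using True len by (simp add: as coface_def cyclic_op_def nth_append)
  qed
qed

locale yetter_drinfeld_finite_dim_coefficients =
  yetter_drinfeld_coefficients H scaleA actA coact scaleV actV
  for H :: "('k::field, 'h::{ring, monoid_mult}) hopf_data"
    and scaleA :: "'k \<Rightarrow> 'a::{ring, monoid_mult} \<Rightarrow> 'a"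
    and actA :: "'h \<Rightarrow> 'a \<Rightarrow> 'a"
    and coact :: "'a \<Rightarrow> ('a \<times> 'h) list set"
    and scaleV :: "'k \<Rightarrow> 'v::ab_group_add \<Rightarrow> 'v"
    and actV :: "'h \<Rightarrow> 'v \<Rightarrow> 'v" +
  assumes finite_dim_V: "finite_dim scaleV"
begin

abbreviation "A_alg \<equiv> type_alg scaleA actA"
abbreviation "\<Psi> \<equiv> Psi H scaleA actA coact scaleV actV"
abbreviation "tr \<equiv> trace scaleV"

lemmas [linear_intros] = linear_map_comp[OF V.linear_map_trace[OF finite_dim_V]]

lemma trace_cycle: "u \<in> endos scaleV \<Longrightarrow> v \<in> endos scaleV \<Longrightarrow> tr (u \<circ> v) = tr (v \<circ> u)"
  by (rule V.trace_comp_commute[OF finite_dim_V])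

definition trace_form :: "('a list \<Rightarrow> 'h \<Rightarrow> 'k) \<Rightarrow> 'h \<Rightarrow> 'a list \<Rightarrow> ('v \<Rightarrow> 'v) \<Rightarrow> 'k" where
  "trace_form f g as w = (\<Sum>(g0, g1)\<leftarrow>\<Delta> g. f as g1 * tr (w \<circ> actV g0))"

lemma trace_form_add:
  "trace_form (\<lambda>as g. f as g + f' as g) g as w = trace_form f g as w + trace_form f' g as w"
  by (simp add: trace_form_def distrib_right case_prod_unfold sum_list_addf)

lemma trace_form_scale: "trace_form (\<lambda>as g. c * f as g) g as w = c * trace_form f g as w"
  by (simp add: trace_form_def sum_list_pair_const_mult mult.assoc)

lemma trace_form_cong: "f as = f' bs \<Longrightarrow> trace_form f g as w = trace_form f' g bs w"
  by (simp add: trace_form_def)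

lemma cochain_multilinear:
  "multilinear_cochain H A_alg n f \<Longrightarrow> multilinear scaleA (*) (Suc n) (\<lambda>as. f as g)"
  by (simp add: multilinear_cochain_type_alg_iff A.unital_algebra_axioms)

lemma cochain_linear:
  "multilinear_cochain H A_alg n f \<Longrightarrow> length as = Suc n \<Longrightarrow> linear_map (hscale H) (*) (f as)"
  by (simp add: multilinear_cochain_type_alg_iff A.unital_algebra_axioms)

lemma word_form_trace_form:
  assumes f: "multilinear_cochain H A_alg n f"
  shows "word_form (Suc n) (trace_form f g)"
  unfolding word_form_def trace_form_def multilinear_def
  by (intro conjI allI impI linear_intros multilinear_slot[OF cochain_multilinear[OF f]]) simp_all

lemma linear_map_trace_form:
  assumes f: "multilinear_cochain H A_alg n f" and "length as = Suc n" and w: "w \<in> endos scaleV"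
  shows "linear_map (hscale H) (*) (\<lambda>g. trace_form f g as w)"
  unfolding trace_form_def
  by (intro linear_intros linear_map_comp[OF cochain_linear[OF f]] assms)

lemma Psi_pure_eq_sum_words:
  "Psi_pure H coact scaleV actV f aus g =
   (\<Sum>(as, w)\<leftarrow>twisted_words (map (\<lambda>p. [p]) aus). trace_form f g as w)"
proof -
  have "Psi_pure H coact scaleV actV f aus g =
      (\<Sum>(g0, g1)\<leftarrow>\<Delta> g. \<Sum>(as, w)\<leftarrow>twisted_words (map (\<lambda>p. [p]) aus). f as g1 * tr (w \<circ> actV g0))"
    unfolding Psi_pure_def by (intro sum_list_pair_cong sum_product_lists_eq_sum_twisted_words)
  also have "\<dots> = (\<Sum>(as, w)\<leftarrow>twisted_words (map (\<lambda>p. [p]) aus). trace_form f g as w)"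
    unfolding trace_form_def by (rule sum_list_pair_swap)
  finally show ?thesis .
qed

lemma Psi_eq_sum_words:
  assumes "bs \<in> tuples A_End (n + 1)"
  shows "\<Psi> n f bs g = (\<Sum>(as, w)\<leftarrow>twisted_words (map sw bs). trace_form f g as w)"
  using assms
  by (simp add: Psi_def Psi_pure_eq_sum_words sum_product_lists_twisted_words_singletons)

lemma tuples_A_End_End_sums: "bs \<in> tuples A_End n \<Longrightarrow> set (map sw bs) \<subseteq> End_sums"
  by (rule map_sw_End_sums) (simp add: tuples_def)

lemma Psi_pure_tensors:
  assumes f: "multilinear_cochain H A_alg n f" and len: "length aus = n + 1"
    and aus: "\<forall>(a, u)\<in>set aus. u \<in> endos scaleV"
  shows "\<Psi> n f (map (\<lambda>(a, u). end_class scaleA scaleV [(a, u)]) aus) g =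
    Psi_pure H coact scaleV actV f aus g"
proof -
  let ?cls = "\<lambda>p. end_class scaleA scaleV [p]"
  have cls: "(\<lambda>(a, u). end_class scaleA scaleV [(a, u)]) = ?cls" by auto
  have pure: "set (map (\<lambda>p. [p]) aus) \<subseteq> End_sums" using aus by auto
  then have tup: "map ?cls aus \<in> tuples A_End (n + 1)"
    using len by (auto simp: tuples_def car_A_End)
  have "list_all2 End_sum_eq (map (\<lambda>p. [p]) aus) (map sw (map ?cls aus))"
    using pure unfolding end_class_def
    by (simp add: list_all2_map1 list_all2_map2 list_all2_same image_subset_iff
        formal_eq_sw_tensor_class)
  from sum_twisted_words_tensor_eq[OF this pure tuples_A_End_End_sums[OF tup]] show ?thesis
    using word_form_trace_form[OF f] len unfolding cls
    by (simp add: Psi_eq_sum_words[OF tup] Psi_pure_eq_sum_words)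
qed

lemma Psi_slot:
  assumes f: "multilinear_cochain H A_alg n f" and bs: "bs \<in> tuples A_End (n + 1)" and "i \<le> n"
  obtains L where "bilinear_form L"
    and "\<And>b. b \<in> car A_End \<Longrightarrow> \<Psi> n f (bs[i := b]) g = (\<Sum>(a, w)\<leftarrow>twist (sw b). L a w)"
proof -
  let ?xss = "map sw (take i bs)" and ?yss = "map sw (drop (Suc i) bs)"
  let ?L = "\<lambda>a w. \<Sum>(as, u)\<leftarrow>twisted_words ?xss. \<Sum>(bs, v)\<leftarrow>twisted_words ?yss.
    trace_form f g (as @ a # bs) (u \<circ> (w \<circ> v))"
  have i: "i < length bs" using bs \<open>i \<le> n\<close> by (simp add: tuples_def)
  have car: "set bs \<subseteq> car A_End" and len: "length bs = Suc n"
    using bs by (simp_all add: tuples_def)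
  have "set ?xss \<subseteq> End_sums" "set ?yss \<subseteq> End_sums"
    by (fact map_sw_take_End_sums[OF car] map_sw_drop_End_sums[OF car])+
  then have "bilinear_form ?L"
    using word_form_trace_form[OF f] i len by (intro bilinear_form_slot) simp_all
  moreover have "\<Psi> n f (bs[i := b]) g = (\<Sum>(a, w)\<leftarrow>twist (sw b). ?L a w)" if "b \<in> car A_End" for b
  proof -
    have "bs[i := b] \<in> tuples A_End (n + 1)"
      using car len that set_update_subset_insert[of bs i b] by (auto simp: tuples_def)
    then show ?thesis
      using i by (simp add: Psi_eq_sum_words upd_conv_take_nth_drop sum_twisted_words_slot)
  qed
  ultimately show thesis by (rule that)
qed

lemma Psi_multilinear_cochain:
  assumes f: "multilinear_cochain H A_alg n f"
  shows "multilinear_cochain H A_End n (\<Psi> n f)"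
  unfolding multilinear_cochain_def
proof (intro conjI allI impI ballI)
  fix bs assume "bs \<notin> tuples A_End (n + 1)"
  then show "\<Psi> n f bs = (\<lambda>g. 0)" by (simp add: Psi_def fun_eq_iff)
next
  fix bs assume bs: "bs \<in> tuples A_End (n + 1)"
  then have "length (map sw bs) = Suc n" by (simp add: tuples_def)
  then show "linear_map (hscale H) (*) (\<Psi> n f bs)"
    unfolding Psi_eq_sum_words[OF bs, abs_def]
    by (intro linear_intros linear_map_trace_form[OF f])
      (simp_all add: twisted_words_mem[OF tuples_A_End_End_sums[OF bs]])
next
  fix bs i b b' g
  assume "bs \<in> tuples A_End (n + 1)" "i \<le> n" and b: "b \<in> car A_End" and b': "b' \<in> car A_End"
  then obtain L where L: "bilinear_form L"
    "\<And>b. b \<in> car A_End \<Longrightarrow> \<Psi> n f (bs[i := b]) g = (\<Sum>(a, w)\<leftarrow>twist (sw b). L a w)"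
    using Psi_slot[OF f] by metis
  show "\<Psi> n f (bs[i := add A_End b b']) g = \<Psi> n f (bs[i := b]) g + \<Psi> n f (bs[i := b']) g"
    using b b' by (simp add: L(2) add_A_End_car sum_twist_add[OF L(1)])
next
  fix bs i c b g
  assume "bs \<in> tuples A_End (n + 1)" "i \<le> n" and b: "b \<in> car A_End"
  then obtain L where L: "bilinear_form L"
    "\<And>b. b \<in> car A_End \<Longrightarrow> \<Psi> n f (bs[i := b]) g = (\<Sum>(a, w)\<leftarrow>twist (sw b). L a w)"
    using Psi_slot[OF f] by metis
  show "\<Psi> n f (bs[i := smul A_End c b]) g = c * \<Psi> n f (bs[i := b]) g"
    using b by (simp add: L(2) smul_A_End_car sum_twist_smul[OF L(1)])
qed

section \<open>Equivariance of \<open>\<Psi>\<close>\<close>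

lemma cochain_equivariant:
  assumes "f \<in> cochains H A_alg n" and "length as = Suc n"
  shows "diag_act n h (\<lambda>as. f as g) as = (\<Sum>(h0, h1)\<leftarrow>\<Delta> h. f as (S h1 * g * h0))"
  using assms by (simp add: cochains_def tuples_def type_alg_def diag_act_def)

lemma diag_act_trace_form:
  assumes f: "f \<in> cochains H A_alg n" and as: "length as = Suc n" and w: "w \<in> endos scaleV"
  shows "diag_act n q (\<lambda>as. trace_form f g as (actV p \<circ> (w \<circ> actV (S y)))) as =
    (\<Sum>(x, z)\<leftarrow>\<Delta> q. \<Sum>(g0, g1)\<leftarrow>\<Delta> g. f as (S z * g1 * x) * tr (w \<circ> actV (S y * g0 * p)))"
proof -
  have cycle: "tr (actV p \<circ> (w \<circ> actV (S y)) \<circ> actV g0) = tr (w \<circ> actV (S y * g0 * p))" for g0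
    using trace_cycle[of "actV p" "w \<circ> actV (S y) \<circ> actV g0"] w
    by (simp add: V.act_endos V.comp_endos V.act_mult_comp comp_assoc)
  have "diag_act n q (\<lambda>as. trace_form f g as (actV p \<circ> (w \<circ> actV (S y)))) as =
      (\<Sum>(g0, g1)\<leftarrow>\<Delta> g. diag_act n q (\<lambda>as. f as g1) as * tr (w \<circ> actV (S y * g0 * p)))"
    by (simp only: diag_act_def trace_form_def cycle sum_list_pair_swap_list[symmetric]
        sum_list_mult_const)
  also have "\<dots> = (\<Sum>(g0, g1)\<leftarrow>\<Delta> g. \<Sum>(x, z)\<leftarrow>\<Delta> q. f as (S z * g1 * x) * tr (w \<circ> actV (S y * g0 * p)))"
    by (simp only: cochain_equivariant[OF f as] sum_list_pair_mult_const)
  also have "\<dots> = (\<Sum>(x, z)\<leftarrow>\<Delta> q. \<Sum>(g0, g1)\<leftarrow>\<Delta> g. f as (S z * g1 * x) * tr (w \<circ> actV (S y * g0 * p)))"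
    by (rule sum_list_pair_swap)
  finally show ?thesis .
qed

lemma trace_form_equivariant:
  assumes f: "f \<in> cochains H A_alg n" and as: "length as = Suc n" and w: "w \<in> endos scaleV"
  shows "(\<Sum>(p, k)\<leftarrow>\<Delta> h. \<Sum>(q, y)\<leftarrow>\<Delta> k.
      diag_act n q (\<lambda>as. trace_form f g as (actV p \<circ> (w \<circ> actV (S y)))) as) =
    (\<Sum>(h0, h1)\<leftarrow>\<Delta> h. trace_form f (S h1 * g * h0) as w)"
proof -
  have "multilinear_cochain H A_alg n f" using f by (simp add: cochains_def)
  note lin = linear_intros linear_map_comp[OF cochain_linear[OF this as]] w
  let ?X = "\<lambda>p x z y. \<Sum>(g0, g1)\<leftarrow>\<Delta> g. f as (S z * g1 * x) * tr (w \<circ> actV (S y * g0 * p))"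
  have "(\<Sum>(p, k)\<leftarrow>\<Delta> h. \<Sum>(q, y)\<leftarrow>\<Delta> k.
        diag_act n q (\<lambda>as. trace_form f g as (actV p \<circ> (w \<circ> actV (S y)))) as) =
      (\<Sum>(p, k)\<leftarrow>\<Delta> h. \<Sum>(q, y)\<leftarrow>\<Delta> k. \<Sum>(x, z)\<leftarrow>\<Delta> q. ?X p x z y)"
    by (simp only: diag_act_trace_form[OF f as w])
  also have "\<dots> = (\<Sum>(p, k)\<leftarrow>\<Delta> h. \<Sum>(x, l)\<leftarrow>\<Delta> k. \<Sum>(z, y)\<leftarrow>\<Delta> l. ?X p x z y)"
    by (rule sum_list_pair_cong, rule coassoc_sum[where t = "(*)"]) (intro lin)
  also have "\<dots> = (\<Sum>(h0, h1)\<leftarrow>\<Delta> h. \<Sum>(p, x)\<leftarrow>\<Delta> h0. \<Sum>(z, y)\<leftarrow>\<Delta> h1. ?X p x z y)"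
    by (rule coassoc_sum[where t = "(*)", symmetric]) (intro lin)
  also have "\<dots> = (\<Sum>(h0, h1)\<leftarrow>\<Delta> h. trace_form f (S h1 * g * h0) as w)"
    unfolding trace_form_def
    by (rule sum_list_pair_cong, rule comult_conj_sum[where t = "(*)", symmetric]) (intro lin)
  finally show ?thesis .
qed

lemma Psi_equivariant:
  assumes f: "f \<in> cochains H A_alg n" and bs: "bs \<in> tuples A_End (n + 1)"
  shows "(\<Sum>hs\<leftarrow>iter_sweedler H n h. \<Psi> n f (map2 (act A_End) hs bs) g) =
    (\<Sum>(h0, h1)\<leftarrow>\<Delta> h. \<Psi> n f bs (S h1 * g * h0))"
proof -
  let ?words = "twisted_words (map sw bs)"
  have len: "length bs = Suc n" and car: "set bs \<subseteq> car A_End" using bs by (auto simp: tuples_def)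
  note word = twisted_words_mem[OF tuples_A_End_End_sums[OF bs]]
  have form: "word_form (Suc n) (trace_form f g)"
    using f by (intro word_form_trace_form) (simp add: cochains_def)
  have "map2 (act A_End) hs bs \<in> tuples A_End (n + 1)" if "hs \<in> set (iter_sweedler H n h)" for hs
    using length_iter_sweedler[OF that] len car
    by (auto simp: tuples_def dest!: set_zip_rightD intro!: act_A_End_car)
  then have "(\<Sum>hs\<leftarrow>iter_sweedler H n h. \<Psi> n f (map2 (act A_End) hs bs) g) =
      (\<Sum>hs\<leftarrow>iter_sweedler H n h.
        \<Sum>(as, w)\<leftarrow>twisted_words (map sw (map2 (act A_End) hs bs)). trace_form f g as w)"
    by (intro sum_list_cong Psi_eq_sum_words)
  also have "\<dots> = (\<Sum>(p, k)\<leftarrow>\<Delta> h. \<Sum>(q, y)\<leftarrow>\<Delta> k. \<Sum>(as, w)\<leftarrow>?words.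
      diag_act n q (\<lambda>as. trace_form f g as (actV p \<circ> (w \<circ> actV (S y)))) as)"
    unfolding sum_twisted_words_act[OF form len car] act_words_right_def ..
  also have "\<dots> = (\<Sum>(as, w)\<leftarrow>?words. \<Sum>(p, k)\<leftarrow>\<Delta> h. \<Sum>(q, y)\<leftarrow>\<Delta> k.
      diag_act n q (\<lambda>as. trace_form f g as (actV p \<circ> (w \<circ> actV (S y)))) as)"
    by (rule sum_list_pair_swap_nested)
  also have "\<dots> = (\<Sum>(as, w)\<leftarrow>?words. \<Sum>(h0, h1)\<leftarrow>\<Delta> h. trace_form f (S h1 * g * h0) as w)"
    using word len by (intro sum_list_pair_cong trace_form_equivariant[OF f]) auto
  also have "\<dots> = (\<Sum>(h0, h1)\<leftarrow>\<Delta> h. \<Psi> n f bs (S h1 * g * h0))"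
    unfolding Psi_eq_sum_words[OF bs] by (rule sum_list_pair_swap)
  finally show ?thesis .
qed

lemma Psi_cochains: "f \<in> cochains H A_alg n \<Longrightarrow> \<Psi> n f \<in> cochains H A_End n"
  using Psi_multilinear_cochain[of n f] Psi_equivariant[of f n] by (simp add: cochains_def)

section \<open>Compatibility of \<open>\<Psi>\<close> with the cocyclic structure\<close>

lemma trace_form_act_comp:
  assumes "w \<in> endos scaleV"
  shows "trace_form f g as (actV p \<circ> w) = (\<Sum>(x, z)\<leftarrow>\<Delta> g. f as z * tr (actV (x * p) \<circ> w))"
  unfolding trace_form_def
proof (rule sum_list_pair_cong)
  fix x z
  have "tr (actV p \<circ> w \<circ> actV x) = tr (actV x \<circ> (actV p \<circ> w))"
    by (intro trace_cycle V.comp_endos V.act_endos assms)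
  then show "f as z * tr (actV p \<circ> w \<circ> actV x) = f as z * tr (actV (x * p) \<circ> w)"
    by (simp only: V.act_mult_comp comp_assoc)
qed

lemma trace_form_cyclic_op_snoc:
  assumes "length as = n" and u: "u \<in> endos scaleV" and w: "w \<in> endos scaleV"
  shows "trace_form (cyclic_op H A_alg n f) g (as @ [a]) (u \<circ> w) =
    (\<Sum>(y, l)\<leftarrow>\<Delta> g. \<Sum>(q, z)\<leftarrow>\<Delta> l. f (actA (S_inv q) a # as) z * tr (actV 1 \<circ> (w \<circ> actV y \<circ> u)))"
proof -
  have "tr (u \<circ> w \<circ> actV y) = tr (actV 1 \<circ> (w \<circ> actV y \<circ> u))" for y
    using trace_cycle[of u "w \<circ> actV y"] u w
    by (simp add: V.comp_endos V.act_endos V.act_one_id comp_assoc)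
  moreover have "cyclic_op H A_alg n f (as @ [a]) l =
      (\<Sum>(q, z)\<leftarrow>\<Delta> l. f (actA (S_inv q) a # as) z)" for l
    using assms(1) by (simp add: cyclic_op_def tuples_def type_alg_def nth_append)
  ultimately show ?thesis
    by (simp only: trace_form_def sum_list_pair_mult_const)
qed

lemma trace_form_cyclic_op:
  assumes f: "multilinear_cochain H A_alg n f" and as: "length as = n"
    and u: "u \<in> endos scaleV" and b: "b \<in> car A_End"
  shows "(\<Sum>(g0, g1)\<leftarrow>\<Delta> g. \<Sum>(a, w)\<leftarrow>twist (sw (act A_End (S_inv g0) b)).
        trace_form f g1 (a # as) (w \<circ> u)) =
    (\<Sum>(a, w)\<leftarrow>twist (sw b). trace_form (cyclic_op H A_alg n f) g (as @ [a]) (u \<circ> w))"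
proof -
  have len: "length (a # as) = Suc n" for a using as by simp
  note form = word_form_trace_form[OF f]
  note twist_b = twist_endos[OF sw_car_A_End[OF b]]
  note lin = linear_intros u linear_map_comp[OF cochain_linear[OF f len]]
    multilinear_head[OF cochain_multilinear[OF f] as]
    multilinear_head[OF word_form_multilinear[OF form] as] word_form_linear[OF form len] twist_b
  define K where "K y q m z = (\<Sum>(a, w)\<leftarrow>twist (sw b).
    f (actA (S_inv q) a # as) z * tr (actV m \<circ> (w \<circ> actV y \<circ> u)))" for y q m z
  have "(\<Sum>(g0, g1)\<leftarrow>\<Delta> g. \<Sum>(a, w)\<leftarrow>twist (sw (act A_End (S_inv g0) b)).
        trace_form f g1 (a # as) (w \<circ> u)) =
      (\<Sum>(g0, g1)\<leftarrow>\<Delta> g. \<Sum>(p, k)\<leftarrow>\<Delta> (S_inv g0). \<Sum>(q, y)\<leftarrow>\<Delta> k. \<Sum>(a, w)\<leftarrow>twist (sw b).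
        trace_form f g1 (actA q a # as) (actV p \<circ> w \<circ> actV (S y) \<circ> u))"
    by (rule sum_list_pair_cong, rule sum_twist_act[OF _ b]) (intro lin)
  also have "\<dots> = (\<Sum>(g0, g1)\<leftarrow>\<Delta> g. \<Sum>(y, k)\<leftarrow>\<Delta> g0. \<Sum>(q, p)\<leftarrow>\<Delta> k. \<Sum>(a, w)\<leftarrow>twist (sw b).
        trace_form f g1 (actA (S_inv q) a # as) (actV (S_inv p) \<circ> w \<circ> actV (S (S_inv y)) \<circ> u))"
    by (rule sum_list_pair_cong, rule comult2_S_inv_sum[where t = "(*)"]) (intro lin; assumption)+
  also have "\<dots> = (\<Sum>(g0, g1)\<leftarrow>\<Delta> g. \<Sum>(y, k)\<leftarrow>\<Delta> g0. \<Sum>(q, p)\<leftarrow>\<Delta> k. \<Sum>(a, w)\<leftarrow>twist (sw b). \<Sum>(x, z)\<leftarrow>\<Delta> g1.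
        f (actA (S_inv q) a # as) z * tr (actV (x * S_inv p) \<circ> (w \<circ> actV y \<circ> u)))"
    by (intro sum_list_pair_cong)
      (simp add: comp_assoc trace_form_act_comp twist_b u V.comp_endos V.act_endos)
  also have "\<dots> = (\<Sum>(g0, g1)\<leftarrow>\<Delta> g. \<Sum>(y, k)\<leftarrow>\<Delta> g0. \<Sum>(q, p)\<leftarrow>\<Delta> k. \<Sum>(x, z)\<leftarrow>\<Delta> g1. K y q (x * S_inv p) z)"
    unfolding K_def by (intro sum_list_pair_cong sum_list_pair_swap)
  also have "\<dots> = (\<Sum>(y, l)\<leftarrow>\<Delta> g. \<Sum>(q, z)\<leftarrow>\<Delta> l. K y q 1 z)"
    unfolding K_def
    by (rule cancel_inner[where t = "(*)", OF cancelling_S_inv]) (intro lin; assumption)+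
  also have "\<dots> = (\<Sum>(a, w)\<leftarrow>twist (sw b). \<Sum>(y, l)\<leftarrow>\<Delta> g. \<Sum>(q, z)\<leftarrow>\<Delta> l.
      f (actA (S_inv q) a # as) z * tr (actV 1 \<circ> (w \<circ> actV y \<circ> u)))"
    unfolding K_def by (rule sum_list_pair_swap_nested)
  also have "\<dots> = (\<Sum>(a, w)\<leftarrow>twist (sw b). trace_form (cyclic_op H A_alg n f) g (as @ [a]) (u \<circ> w))"
    by (intro sum_list_pair_cong trace_form_cyclic_op_snoc[OF as u, symmetric] twist_b)
  finally show ?thesis .
qed

lemma Psi_cyclic_op:
  assumes f: "multilinear_cochain H A_alg n f"
  shows "\<Psi> n (cyclic_op H A_alg n f) = cyclic_op H A_End n (\<Psi> n f)"
proof (intro ext)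
  fix bs g
  show "\<Psi> n (cyclic_op H A_alg n f) bs g = cyclic_op H A_End n (\<Psi> n f) bs g"
  proof (cases "bs \<in> tuples A_End (n + 1)")
    case False
    then show ?thesis by (simp add: Psi_def cyclic_op_def)
  next
    case True
    then have "length bs = Suc n" and "set bs \<subseteq> car A_End" by (auto simp: tuples_def)
    then obtain cs b where bs: "bs = cs @ [b]" and len: "length cs = n" and b: "b \<in> car A_End"
      and cs: "set cs \<subseteq> car A_End"
      by (cases bs rule: rev_cases) auto
    let ?words = "twisted_words (map sw cs)"
    note word = twisted_words_mem[OF map_sw_End_sums[OF cs]]
    have tup: "act A_End h b # cs \<in> tuples A_End (n + 1)" for h
      using len cs act_A_End_car[OF b] by (simp add: tuples_def)
    have "cyclic_op H A_End n (\<Psi> n f) bs g =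
        (\<Sum>(g0, g1)\<leftarrow>\<Delta> g. \<Sum>(a, w)\<leftarrow>twist (sw (act A_End (S_inv g0) b)). \<Sum>(as, u)\<leftarrow>?words.
          trace_form f g1 (a # as) (w \<circ> u))"
      using True by (simp add: cyclic_op_def bs len nth_append Psi_eq_sum_words[OF tup, abs_def]
          sum_twisted_words_Cons del: twisted_words.simps(2))
    also have "\<dots> = (\<Sum>(as, u)\<leftarrow>?words. \<Sum>(g0, g1)\<leftarrow>\<Delta> g.
        \<Sum>(a, w)\<leftarrow>twist (sw (act A_End (S_inv g0) b)). trace_form f g1 (a # as) (w \<circ> u))"
      by (rule sum_list_pair_swap_nested)
    also have "\<dots> = (\<Sum>(as, u)\<leftarrow>?words. \<Sum>(a, w)\<leftarrow>twist (sw b).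
        trace_form (cyclic_op H A_alg n f) g (as @ [a]) (u \<circ> w))"
      using word len by (intro sum_list_pair_cong trace_form_cyclic_op[OF f _ _ b]) auto
    also have "\<dots> = \<Psi> n (cyclic_op H A_alg n f) bs g"
      using Psi_eq_sum_words[OF True]
      by (simp add: bs sum_twisted_words_append sum_twisted_words_Cons del: twisted_words.simps(2))
    finally show ?thesis by simp
  qed
qed

lemma Psi_coface_inner:
  assumes f: "multilinear_cochain H A_alg n f" and i: "i \<le> n"
  shows "\<Psi> (Suc n) (coface H A_alg (Suc n) i f) = coface H A_End (Suc n) i (\<Psi> n f)"
proof (intro ext)
  fix bs g
  show "\<Psi> (Suc n) (coface H A_alg (Suc n) i f) bs g = coface H A_End (Suc n) i (\<Psi> n f) bs g"
  proof (cases "bs \<in> tuples A_End (Suc n + 1)")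
    case False
    then show ?thesis by (simp add: Psi_def coface_def)
  next
    case True
    then have len: "length bs = Suc (Suc n)" and car: "set bs \<subseteq> car A_End"
      by (simp_all add: tuples_def)
    let ?merged = "take i bs @ mul A_End (bs ! i) (bs ! (i + 1)) # drop (i + 2) bs"
    have "bs ! i \<in> car A_End" "bs ! (i + 1) \<in> car A_End"
      using len i by (auto intro: subsetD[OF car nth_mem])
    then have tup: "?merged \<in> tuples A_End (n + 1)"
      using car len i mul_A_End_car by (auto simp: tuples_def dest: in_set_takeD in_set_dropD)
    have "coface H A_End (Suc n) i (\<Psi> n f) bs g =
        (\<Sum>(as, w)\<leftarrow>twisted_words (map sw ?merged). trace_form f g as w)"
      using True i Psi_eq_sum_words[OF tup] by (simp add: coface_def)
    also have "\<dots> = (\<Sum>(as, w)\<leftarrow>twisted_words (map sw bs).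
        trace_form f g (take i as @ as ! i * as ! (i + 1) # drop (i + 2) as) w)"
      using i by (intro sum_twisted_words_mul_nth[OF word_form_trace_form[OF f] car len]) simp
    also have "\<dots> = (\<Sum>(as, w)\<leftarrow>twisted_words (map sw bs).
        trace_form (coface H A_alg (Suc n) i f) g as w)"
      using twisted_words_mem[OF map_sw_End_sums[OF car]] len i
      by (intro sum_list_pair_cong trace_form_cong ext)
        (simp add: coface_def tuples_def type_alg_def)
    also have "\<dots> = \<Psi> (Suc n) (coface H A_alg (Suc n) i f) bs g"
      by (rule Psi_eq_sum_words[OF True, symmetric])
    finally show ?thesis by simp
  qed
qed

lemma multilinear_cochain_coface_0:
  assumes f: "multilinear_cochain H A_alg n f"
  shows "multilinear_cochain H A_alg (Suc n) (coface H A_alg (Suc n) 0 f)"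
proof -
  let ?df = "coface H A_alg (Suc n) 0 f"
  have df: "?df (a # b # as) = f (a * b # as)" if "length as = n" for a b as
    using that by (simp add: coface_def tuples_def type_alg_def fun_eq_iff)
  have "linear_map (hscale H) (*) (?df as)" if len: "length as = Suc (Suc n)" for as
  proof -
    obtain a b as' where "as = a # b # as'" "length as' = n"
      using len by (auto simp: length_Suc_conv)
    then show ?thesis using cochain_linear[OF f, of "a * b # as'"] by (simp add: df)
  qed
  moreover have "linear_map scaleA (*) (\<lambda>x. ?df (as @ x # bs) g)"
    if len: "length as + length bs + 1 = Suc (Suc n)" for as bs g
  proof -
    consider b bs' where "as = []" "bs = b # bs'" | a where "as = [a]"
      | a b as' where "as = a # b # as'"
      using len by (cases as; cases "tl as"; cases bs) auto
    then show ?thesis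
    proof cases
      case 1
      then show ?thesis
        using len
        by (simp add: df)
          (intro multilinear_head[OF cochain_multilinear[OF f]] linear_intros; simp)
    next
      case 2
      then show ?thesis
        using len
        by (simp add: df)
          (intro multilinear_head[OF cochain_multilinear[OF f]] linear_intros; simp)
    next
      case 3
      then show ?thesis
        using len
          multilinear_slot[OF cochain_multilinear[OF f] _ A.linear_ident, of "a * b # as'" bs]
        by (simp add: df)
    qed
  qed
  ultimately show ?thesis
    by (simp add: multilinear_cochain_type_alg_iff[OF A.unital_algebra_axioms] multilinear_def)
      (simp add: coface_def tuples_def type_alg_def fun_eq_iff)
qed

lemma Psi_coface:
  assumes f: "multilinear_cochain H A_alg n f" and "i \<le> Suc n"
  shows "\<Psi> (Suc n) (coface H A_alg (Suc n) i f) = coface H A_End (Suc n) i (\<Psi> n f)"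
proof (cases "i = Suc n")
  case True
  then show ?thesis
    using Psi_cyclic_op[OF multilinear_cochain_coface_0[OF f]] Psi_coface_inner[OF f, of 0]
    by (simp add: coface_last act_A_End_car type_alg_def)
next
  case False
  then show ?thesis using Psi_coface_inner[OF f] \<open>i \<le> Suc n\<close> by simp
qed

lemma Psi_codegeneracy:
  assumes f: "multilinear_cochain H A_alg (Suc n) f" and i: "i \<le> n"
  shows "\<Psi> n (codegeneracy A_alg n i f) = codegeneracy A_End n i (\<Psi> (Suc n) f)"
proof (intro ext)
  fix bs g
  show "\<Psi> n (codegeneracy A_alg n i f) bs g = codegeneracy A_End n i (\<Psi> (Suc n) f) bs g"
  proof (cases "bs \<in> tuples A_End (n + 1)")
    case False
    then show ?thesis by (simp add: Psi_def codegeneracy_def)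
  next
    case True
    let ?cs = "take (i + 1) bs" and ?ds = "drop (i + 1) bs"
    have len: "length bs = Suc n" and car: "set bs \<subseteq> car A_End"
      using True by (simp_all add: tuples_def)
    then have tup: "?cs @ unt A_End # ?ds \<in> tuples A_End (Suc n + 1)"
      using i unt_A_End_car by (auto simp: tuples_def dest: in_set_takeD in_set_dropD)
    have form: "word_form (length (map sw ?cs) + length (map sw ?ds) + 1) (trace_form f g)"
      using word_form_trace_form[OF f] len i by simp
    have "codegeneracy A_End n i (\<Psi> (Suc n) f) bs g =
        (\<Sum>(as, w)\<leftarrow>twisted_words (map sw ?cs @ sw (unt A_End) # map sw ?ds). trace_form f g as w)"
      using True Psi_eq_sum_words[OF tup] by (simp add: codegeneracy_def)
    also have "\<dots> = (\<Sum>(as, w)\<leftarrow>twisted_words (map sw ?cs @ map sw ?ds).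
        trace_form f g (take (length (map sw ?cs)) as @ 1 # drop (length (map sw ?cs)) as) w)"
      by (rule sum_twisted_words_unt[OF form map_sw_take_End_sums[OF car]
            map_sw_drop_End_sums[OF car]])
    also have "\<dots> = (\<Sum>(as, w)\<leftarrow>twisted_words (map sw bs).
        trace_form (codegeneracy A_alg n i f) g as w)"
      unfolding map_append[symmetric] append_take_drop_id
      using twisted_words_mem[OF map_sw_End_sums[OF car]] len i
      by (intro sum_list_pair_cong trace_form_cong ext)
        (simp add: codegeneracy_def tuples_def type_alg_def)
    also have "\<dots> = \<Psi> n (codegeneracy A_alg n i f) bs g"
      by (rule Psi_eq_sum_words[OF True, symmetric])
    finally show ?thesis by simp
  qed
qed

lemma Psi_add: "\<Psi> n (\<lambda>as g. f as g + f' as g) bs g = \<Psi> n f bs g + \<Psi> n f' bs g"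
  by (cases "bs \<in> tuples A_End (n + 1)")
    (simp_all add: Psi_eq_sum_words trace_form_add case_prod_unfold sum_list_addf,
      simp add: Psi_def)

lemma Psi_scale: "\<Psi> n (\<lambda>as g. c * f as g) bs g = c * \<Psi> n f bs g"
  by (cases "bs \<in> tuples A_End (n + 1)")
    (simp_all add: Psi_eq_sum_words trace_form_scale sum_list_pair_const_mult, simp add: Psi_def)

lemma Psi_cocyclic_morphism: "cocyclic_morphism H A_alg A_End \<Psi>"
proof -
  have multilinear: "multilinear_cochain H A_alg n f" if "f \<in> cochains H A_alg n" for n f
    using that by (simp add: cochains_def)
  show ?thesis
    unfolding cocyclic_morphism_def
  proof (intro conjI allI ballI impI)
    fix n i f assume "1 \<le> n" "i \<le> n" "f \<in> cochains H A_alg (n - 1)"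
    then show "\<Psi> n (coface H A_alg n i f) = coface H A_End n i (\<Psi> (n - 1) f)"
      using Psi_coface[OF multilinear, of f "n - 1" i] by simp
  next
    fix n i f assume "i \<le> n" "f \<in> cochains H A_alg (n + 1)"
    then show "\<Psi> n (codegeneracy A_alg n i f) = codegeneracy A_End n i (\<Psi> (n + 1) f)"
      using Psi_codegeneracy[of n f i] multilinear by simp
  qed (simp_all only: Psi_cochains Psi_add Psi_scale Psi_cyclic_op[OF multilinear])
qed

end

theorem proposition5p2:
  fixes H :: "('k::field_char_0, 'h::{ring, monoid_mult}) hopf_data"
    and scaleA :: "'k \<Rightarrow> 'a::{ring, monoid_mult} \<Rightarrow> 'a"
    and actA :: "'h \<Rightarrow> 'a \<Rightarrow> 'a"
    and coact :: "'a \<Rightarrow> ('a \<times> 'h) list set"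
    and scaleV :: "'k \<Rightarrow> 'v::ab_group_add \<Rightarrow> 'v"
    and actV :: "'h \<Rightarrow> 'v \<Rightarrow> 'v"
  assumes "hopf_algebra H"
    and "bij (antipode H)"
    and "yetter_drinfeld_algebra H scaleA actA coact"
    and "hopf_module H scaleV actV"
    and "finite_dim scaleV"
  shows "(\<forall>n. \<forall>f\<in>cochains H (type_alg scaleA actA) n. \<forall>aus g.
            length aus = n + 1 \<longrightarrow> (\<forall>(a, u)\<in>set aus. u \<in> endos scaleV) \<longrightarrow>
            Psi H scaleA actA coact scaleV actV n f
              (map (\<lambda>(a, u). end_class scaleA scaleV [(a, u)]) aus) g =
            Psi_pure H coact scaleV actV f aus g)
       \<and> cocyclic_morphism H (type_alg scaleA actA) (end_alg H scaleA actA coact scaleV actV)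
            (Psi H scaleA actA coact scaleV actV)"
proof -
  interpret yetter_drinfeld_finite_dim_coefficients H scaleA actA coact scaleV actV
    using assms
    by (intro yetter_drinfeld_finite_dim_coefficients.intro yetter_drinfeld_coefficients.intro
        yetter_drinfeld_hopf_algebra.intro bijective_hopf_algebra.intro hopf_representation.intro
        bijective_hopf_algebra_axioms.intro yetter_drinfeld_finite_dim_coefficients_axioms.intro)
  show ?thesis
    using Psi_pure_tensors Psi_cocyclic_morphism by (auto simp: cochains_def)
qed

end
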